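(* Identify $O_q$ with the subalgebra $\langle \mathcal W_0,\mathcal W_1\rangle$ of $\mathcal O_q$ via the injective algebra homomorphism $\imath:O_q\to\mathcal O_q$, $W_0\mapsto\mathcal W_0$, $W_1\mapsto \mathcal W_1$. Then for the algebra $\mathcal O_q$, \begin{align*} \frac{q+q^{-1}}{t+t^{-1}}\,\mathcal W^-\Bigl(\frac{q+q^{-1}}{t+t^{-1}}\Bigr) &= \frac{q^{-1}tB^+(q^{-1}t)+B^-(qt)}{(q^2-q^{-2})(t-t^{-1})}\,\mathcal{\tilde G}\Bigl(\frac{q+q^{-1}}{t+t^{-1}}\Bigr),\\ \frac{q+q^{-1}}{t+t^{-1}}\,\mathcal W^+\Bigl(\frac{q+q^{-1}}{t+t^{-1}}\Bigr) &= \frac{B^+(q^{-1}t)+qtB^-(qt)}{(q^2-q^{-2})(t-t^{-1})}\,\mathcal{\tilde G}\Bigl(\frac{q+q^{-1}}{t+t^{-1}}\Bigr). \end{align*}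
   Context: $\mathbb F$ is a field; $q\in\mathbb F$ is nonzero and not a root of unity; $\mathbb N=\{0,1,2,\ldots\}$; $[n]_q=(q^n-q^{-n})/(q-q^{-1})$. Algebras are associative, unital, over $\mathbb F$. $[X,Y]=XY-YX$ and $[X,Y]_r=rXY-r^{-1}YX$ for nonzero $r \in \mathbb F$. The $q$-Onsager algebra $O_q$ has generators $W_0,W_1$ and relations $[W_0,[W_0,[W_0,W_1]_q]_{q^{-1}}]=(q^2-q^{-2})^2[W_1,W_0]$ and $[W_1,[W_1,[W_1,W_0]_q]_{q^{-1}}]=(q^2-q^{-2})^2[W_0,W_1]$. Elements of $O_q$: $B_\delta=q^{-2}W_1W_0-W_0W_1$; with $c=q/((q-q^{-1})(q^2-q^{-2}))$: $B_{\alpha_0}=W_0$, $B_{\delta+\alpha_0}=W_1+c[B_\delta,W_0]$, $B_{n\delta+\alpha_0}=B_{(n-2)\delta+\alpha_0}+c[B_\delta,B_{(n-1)\delta+\alpha_0}]$ for $n\ge2$; $B_{\alpha_1}=W_1$, $B_{\delta+\alpha_1}=W_0-c[B_\delta,W_1]$, $B_{n\delta+\alpha_1}=B_{(n-2)\delta+\alpha_1}-c[B_\delta,B_{(n-1)\delta+\alpha_1}]$ for $n\ge 2$. Set $B^-(t)=\sum_{n\in\mathbb N}B_{n\delta+\alpha_0}t^n$, $B^+(t)=\sum_{n\in\mathbb N}B_{n\delta+\alpha_1}t^n$. The algebra $\mathcal O_q$ has generators $\mathcal W_{-k},\mathcal W_{k+1},\mathcal G_{k+1},\mathcal{\tilde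 G}_{k+1}$ ($k\in\mathbb N$) and the following relations for $k,\ell\in\mathbb N$, where $\rho=-(q^2-q^{-2})^2$: $[\mathcal W_0,\mathcal W_{k+1}]=[\mathcal W_{-k},\mathcal W_1]=(\mathcal{\tilde G}_{k+1}-\mathcal G_{k+1})/(q+q^{-1})$; $[\mathcal W_0,\mathcal G_{k+1}]_q=[\mathcal{\tilde G}_{k+1},\mathcal W_0]_q=\rho\mathcal W_{-k-1}-\rho\mathcal W_{k+1}$; $[\mathcal G_{k+1},\mathcal W_1]_q=[\mathcal W_1,\mathcal{\tilde G}_{k+1}]_q=\rho\mathcal W_{k+2}-\rho\mathcal W_{-k}$; $[\mathcal W_{-k},\mathcal W_{-\ell}]=0$; $[\mathcal W_{k+1},\mathcal W_{\ell+1}]=0$; $[\mathcal W_{-k},\mathcal W_{\ell+1}]+[\mathcal W_{k+1},\mathcal W_{-\ell}]=0$; $[\mathcal W_{-k},\mathcal G_{\ell+1}]+[\mathcal G_{k+1},\mathcal W_{-\ell}]=0$; $[\mathcal W_{-k},\mathcal{\tilde G}_{\ell+1}]+[\mathcal{\tilde G}_{k+1},\mathcal W_{-\ell}]=0$; $[\mathcal W_{k+1},\mathcal G_{\ell+1}]+[\mathcal G_{k+1},\mathcal W_{\ell+1}]=0$; $[\mathcal W_{k+1},\mathcal{\tilde G}_{\ell+1}]+[\mathcal{\tilde G}_{k+1},\mathcal W_{\ell+1}]=0$; $[\mathcal G_{k+1},\mathcal G_{\ell+1}]=0$; $[\mathcal{\tilde G}_{k+1},\mathcal{\tilde G}_{\ell+1}]=0$;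 $[\mathcal{\tilde G}_{k+1},\mathcal G_{\ell+1}]+[\mathcal G_{k+1},\mathcal{\tilde G}_{\ell+1}]=0$. Also $\mathcal G_0=\mathcal{\tilde G}_0=-(q-q^{-1})[2]_q^2$. Set $\mathcal W^-(t)=\sum_{n\in\mathbb N}\mathcal W_{-n}t^n$, $\mathcal W^+(t)=\sum_{n\in\mathbb N}\mathcal W_{n+1}t^n$, $\mathcal{\tilde G}(t)=\sum_{n\in\mathbb N}\mathcal{\tilde G}_nt^n$. It is known from earlier work that $\imath$ exists and is injective. Identities are between formal power series in $t$ over $\mathcal O_q$; $\frac{q+q^{-1}}{t+t^{-1}}$ means the series $(q+q^{-1})\sum_{\ell\in\mathbb N}(-1)^\ell t^{2\ell+1}$, and $(t-t^{-1})^{-1}$ means $-\sum_{\ell\in\mathbb N}t^{2\ell+1}$. *)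

theory Defs
  imports
    "HOL-Library.Poly_Mapping"
    "HOL-Computational_Algebra.Formal_Power_Series"
    "HOL-Algebra.QuotRing"
    "HOL-Algebra.Module"
begin

text \<open>
  An associative unital algebra over a field \<open>'f\<close> is represented by a record of type
  \<open>('f, 'a) module\<close>: the ring operations together with the scalar action. (The locale
  \<open>algebra\<close> of HOL-Algebra is not used because it requires commutativity.)
\<close>


section \<open>Free algebras, quotients, presentations\<close>

text \<open>
  The free algebra on a set of generators is the monoid algebra of the free monoid of words.
  The free monoid is written additively, because that is what the convolution
  product on \<open>_ \<Rightarrow>\<^sub>0 _\<close> expects.
\<close>

datatype 'g word = Word (letters: "'g list")

instantiation word :: (type) monoid_add
begin

definition zero_word :: "'g word"
  where "zero_word = Word []"

definition plus_word :: "'g word \<Rightarrow> 'g word \<Rightarrow> 'g word"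
  where "plus_word u v = Word (letters u @ letters v)"

instance
  by standard (simp_all add: zero_word_def plus_word_def)

end

type_synonym ('g, 'f) free_elt = "'g word \<Rightarrow>\<^sub>0 'f"

definition free_alg :: "('f::field, ('g, 'f) free_elt) module"
  where "free_alg =
    \<lparr>carrier = UNIV, mult = (*), one = 1, zero = 0, add = (+),
     smult = (\<lambda>c x. Poly_Mapping.single 0 c * x)\<rparr>"

definition free_gen :: "'g \<Rightarrow> ('g, 'f::field) free_elt"
  where "free_gen g = Poly_Mapping.single (Word [g]) 1"

text \<open>The quotient ring \<open>A Quot I\<close> with its induced scalar action.\<close>

definition quot_alg :: "('f, 'a) module \<Rightarrow> 'a set \<Rightarrow> ('f, 'a set) module"
  where "quot_alg A I =
    ring.extend (A Quot I) (module.fields (\<lambda>c X. \<Union>x\<in>X. I +>\<^bsub>A\<^esub> (c \<odot>\<^bsub>A\<^esub> x)))"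

definition rel_ideal :: "(('g, 'f::field) free_elt \<times> ('g, 'f) free_elt) set
    \<Rightarrow> ('g, 'f) free_elt set"
  where "rel_ideal R = Idl\<^bsub>free_alg\<^esub> ((\<lambda>(x, y). x - y) ` R)"

definition presented_alg :: "(('g, 'f::field) free_elt \<times> ('g, 'f) free_elt) set
    \<Rightarrow> ('f, ('g, 'f) free_elt set) module"
  where "presented_alg R = quot_alg free_alg (rel_ideal R)"

definition presented_gen :: "(('g, 'f::field) free_elt \<times> ('g, 'f) free_elt) set
    \<Rightarrow> 'g \<Rightarrow> ('g, 'f) free_elt set"
  where "presented_gen R g = rel_ideal R +>\<^bsub>free_alg\<^esub> free_gen g"

definition alg_hom :: "('f, 'a) module \<Rightarrow> ('f, 'b) module \<Rightarrow> ('a \<Rightarrow> 'b) set"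
  where "alg_hom A B =
    {h \<in> ring_hom A B. \<forall>c. \<forall>x\<in>carrier A. h (c \<odot>\<^bsub>A\<^esub> x) = c \<odot>\<^bsub>B\<^esub> h x}"

lemma ring_free_alg: "ring (free_alg :: ('f::field, ('g, 'f) free_elt) module)"
proof (rule ringI)
  show "abelian_group (free_alg :: ('f, ('g, 'f) free_elt) module)"
  proof (rule abelian_groupI)
    fix x :: "('g, 'f) free_elt"
    assume "x \<in> carrier free_alg"
    show "\<exists>y\<in>carrier free_alg. y \<oplus>\<^bsub>free_alg\<^esub> x = \<zero>\<^bsub>free_alg\<^esub>"
      by (rule bexI[of _ "- x"]) (simp_all add: free_alg_def)
  qed (simp_all add: free_alg_def ac_simps)
  show "Group.monoid (free_alg :: ('f, ('g, 'f) free_elt) module)"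
    by (rule monoidI) (simp_all add: free_alg_def mult.assoc)
qed (simp_all add: free_alg_def algebra_simps)

lemma ideal_rel_ideal: "ideal (rel_ideal R) free_alg"
  unfolding rel_ideal_def
  by (rule ring.genideal_ideal[OF ring_free_alg]) (simp add: free_alg_def)

lemma presented_alg_simps:
  "carrier (presented_alg R) = carrier (free_alg Quot rel_ideal R)"
  "mult (presented_alg R) = mult (free_alg Quot rel_ideal R)"
  "one (presented_alg R) = one (free_alg Quot rel_ideal R)"
  "zero (presented_alg R) = zero (free_alg Quot rel_ideal R)"
  "add (presented_alg R) = add (free_alg Quot rel_ideal R)"
  "smult (presented_alg R) =
    (\<lambda>c X. \<Union>x\<in>X. rel_ideal R +>\<^bsub>free_alg\<^esub> (c \<odot>\<^bsub>free_alg\<^esub> x))"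
  by (simp_all only: presented_alg_def quot_alg_def ring.defs module.defs
      partial_object.simps monoid.simps ring.simps module.simps)

lemma ring_presented_alg: "ring (presented_alg R)"
proof -
  interpret Q: ring "free_alg Quot rel_ideal R"
    by (rule ideal.quotient_is_ring[OF ideal_rel_ideal])
  show ?thesis
  proof (rule ringI)
    show "abelian_group (presented_alg R)"
      by (rule abelian_groupI; unfold presented_alg_simps)
        (metis Q.a_closed Q.zero_closed Q.a_assoc Q.a_comm Q.l_zero Q.l_neg Q.a_inv_closed)+
    show "Group.monoid (presented_alg R)"
      by (rule monoidI; unfold presented_alg_simps)
        (metis Q.m_closed Q.one_closed Q.m_assoc Q.l_one Q.r_one)+
  qed (unfold presented_alg_simps, (metis Q.l_distr Q.r_distr)+)
qed

lemma smult_presented_alg: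
  "c \<odot>\<^bsub>presented_alg R\<^esub> (rel_ideal R +>\<^bsub>free_alg\<^esub> x)
    = rel_ideal R +>\<^bsub>free_alg\<^esub> (c \<odot>\<^bsub>free_alg\<^esub> x)"
proof -
  let ?I = "rel_ideal R"
  interpret ideal ?I free_alg
    by (rule ideal_rel_ideal)
  have coset: "?I +>\<^bsub>free_alg\<^esub> (c \<odot>\<^bsub>free_alg\<^esub> y) = ?I +>\<^bsub>free_alg\<^esub> (c \<odot>\<^bsub>free_alg\<^esub> x)"
    if y: "y \<in> ?I +>\<^bsub>free_alg\<^esub> x" for y
  proof -
    obtain i where i: "i \<in> ?I" and yi: "y = i + x"
      using y by (auto simp: a_r_coset_def' free_alg_def)
    have "Poly_Mapping.single 0 c * i \<in> ?I"
      using I_l_closed[OF i, of "Poly_Mapping.single 0 c"] by (simp add: free_alg_def)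
    then have "c \<odot>\<^bsub>free_alg\<^esub> y \<in> ?I +>\<^bsub>free_alg\<^esub> (c \<odot>\<^bsub>free_alg\<^esub> x)"
      by (auto simp: a_r_coset_def' free_alg_def yi distrib_left)
    then show ?thesis
      using a_repr_independence'[of "c \<odot>\<^bsub>free_alg\<^esub> y" "c \<odot>\<^bsub>free_alg\<^esub> x"]
      by (simp add: free_alg_def)
  qed
  have "x \<in> ?I +>\<^bsub>free_alg\<^esub> x"
    by (rule a_rcos_self) (simp add: free_alg_def)
  then show ?thesis
    unfolding presented_alg_simps using coset by blast
qed


section \<open>Formal power series over an algebra\<close>

text \<open>
  The \<open>n\<close>-th coefficient of a series is its value at \<open>n\<close>. The indeterminate commutes with
  the coefficients. The scalars are the formal power series over the ground field, so that
  \<open>A[[t]]\<close> is an algebra over \<open>'f[[t]]\<close>.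
\<close>

definition series_alg :: "('f::field, 'a) module \<Rightarrow> ('f fps, nat \<Rightarrow> 'a) module"
  where "series_alg A =
    \<lparr>carrier = UNIV \<rightarrow> carrier A,
     mult = (\<lambda>f g n. \<Oplus>\<^bsub>A\<^esub>i\<in>{..n}. f i \<otimes>\<^bsub>A\<^esub> g (n - i)),
     one = (\<lambda>n. if n = 0 then \<one>\<^bsub>A\<^esub> else \<zero>\<^bsub>A\<^esub>),
     zero = (\<lambda>n. \<zero>\<^bsub>A\<^esub>),
     add = (\<lambda>f g n. f n \<oplus>\<^bsub>A\<^esub> g n),
     smult = (\<lambda>a f n. \<Oplus>\<^bsub>A\<^esub>i\<in>{..n}. fps_nth a i \<odot>\<^bsub>A\<^esub> f (n - i))\<rparr>"

text \<open>
  Substitution of a scalar series \<open>s\<close> with zero constant term. The sum may stop at \<open>n\<close>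
  because the \<open>n\<close>-th coefficient of \<open>s ^ k\<close> vanishes for \<open>k > n\<close>.
\<close>

definition series_subst :: "('f::field, 'a) module \<Rightarrow> (nat \<Rightarrow> 'a) \<Rightarrow> 'f fps \<Rightarrow> nat \<Rightarrow> 'a"
  where "series_subst A f s n = (\<Oplus>\<^bsub>A\<^esub>k\<in>{..n}. fps_nth (s ^ k) n \<odot>\<^bsub>A\<^esub> f k)"


section \<open>The \<open>q\<close>-Onsager algebra and its alternating central extension\<close>

definition lie :: "('f::field, 'a) module \<Rightarrow> 'a \<Rightarrow> 'a \<Rightarrow> 'a"
  where "lie A x y = x \<otimes>\<^bsub>A\<^esub> y \<ominus>\<^bsub>A\<^esub> y \<otimes>\<^bsub>A\<^esub> x"

definition lie_r :: "('f::field, 'a) module \<Rightarrow> 'f \<Rightarrow> 'a \<Rightarrow> 'a \<Rightarrow> 'a"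
  where "lie_r A r x y =
    r \<odot>\<^bsub>A\<^esub> (x \<otimes>\<^bsub>A\<^esub> y) \<ominus>\<^bsub>A\<^esub> inverse r \<odot>\<^bsub>A\<^esub> (y \<otimes>\<^bsub>A\<^esub> x)"

definition q_int :: "'f::field \<Rightarrow> nat \<Rightarrow> 'f"
  where "q_int q n = (q ^ n - inverse q ^ n) / (q - inverse q)"

text \<open>\<open>q\<^sup>2 - q\<^sup>-\<^sup>2\<close>\<close>

definition q2 :: "'f::field \<Rightarrow> 'f"
  where "q2 q = q ^ 2 - inverse q ^ 2"

datatype onsager_gen = W0 | W1

definition onsager_rels ::
  "'f::field \<Rightarrow> ((onsager_gen, 'f) free_elt \<times> (onsager_gen, 'f) free_elt) set"
  where "onsager_rels q =
    (let F = free_alg; w0 = free_gen W0; w1 = free_gen W1 in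
     {(lie F w0 (lie_r F (inverse q) w0 (lie_r F q w0 w1)), (q2 q)\<^sup>2 \<odot>\<^bsub>F\<^esub> lie F w1 w0),
      (lie F w1 (lie_r F (inverse q) w1 (lie_r F q w1 w0)), (q2 q)\<^sup>2 \<odot>\<^bsub>F\<^esub> lie F w0 w1)})"

definition onsager :: "'f::field \<Rightarrow> ('f, (onsager_gen, 'f) free_elt set) module"
  where "onsager q = presented_alg (onsager_rels q)"

definition onsager_W :: "'f::field \<Rightarrow> onsager_gen \<Rightarrow> (onsager_gen, 'f) free_elt set"
  where "onsager_W q g = presented_gen (onsager_rels q) g"

definition B_delta :: "'f::field \<Rightarrow> (onsager_gen, 'f) free_elt set"
  where "B_delta q =
    inverse q ^ 2 \<odot>\<^bsub>onsager q\<^esub> (onsager_W q W1 \<otimes>\<^bsub>onsager q\<^esub> onsager_W q W0)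
      \<ominus>\<^bsub>onsager q\<^esub> onsager_W q W0 \<otimes>\<^bsub>onsager q\<^esub> onsager_W q W1"

definition B_const :: "'f::field \<Rightarrow> 'f"
  where "B_const q = q / ((q - inverse q) * q2 q)"

text \<open>\<open>B_alpha0 q n\<close> and \<open>B_alpha1 q n\<close> are \<open>B\<close> with index \<open>n\<delta> + \<alpha>\<^sub>0\<close> and \<open>n\<delta> + \<alpha>\<^sub>1\<close>.\<close>

fun B_alpha0 :: "'f::field \<Rightarrow> nat \<Rightarrow> (onsager_gen, 'f) free_elt set"
  where
    "B_alpha0 q 0 = onsager_W q W0"
  | "B_alpha0 q (Suc 0) =
      onsager_W q W1 \<oplus>\<^bsub>onsager q\<^esub>
        B_const q \<odot>\<^bsub>onsager q\<^esub> lie (onsager q) (B_delta q) (onsager_W q W0)"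
  | "B_alpha0 q (Suc (Suc n)) =
      B_alpha0 q n \<oplus>\<^bsub>onsager q\<^esub>
        B_const q \<odot>\<^bsub>onsager q\<^esub> lie (onsager q) (B_delta q) (B_alpha0 q (Suc n))"

fun B_alpha1 :: "'f::field \<Rightarrow> nat \<Rightarrow> (onsager_gen, 'f) free_elt set"
  where
    "B_alpha1 q 0 = onsager_W q W1"
  | "B_alpha1 q (Suc 0) =
      onsager_W q W0 \<ominus>\<^bsub>onsager q\<^esub>
        B_const q \<odot>\<^bsub>onsager q\<^esub> lie (onsager q) (B_delta q) (onsager_W q W1)"
  | "B_alpha1 q (Suc (Suc n)) =
      B_alpha1 q n \<ominus>\<^bsub>onsager q\<^esub>
        B_const q \<odot>\<^bsub>onsager q\<^esub> lie (onsager q) (B_delta q) (B_alpha1 q (Suc n))"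

text \<open>
  The generators of the algebra \<open>\<O>\<^sub>q\<close>: for a natural number \<open>k\<close>, the constructors stand for
  \<open>\<W>\<close> with index \<open>-k\<close>, \<open>\<W>\<close> with index \<open>k + 1\<close>, \<open>\<G>\<close> with index \<open>k + 1\<close>, and
  \<open>\<G>\<close>-tilde with index \<open>k + 1\<close>.
\<close>

datatype ace_gen = Wm nat | Wp nat | Gp nat | Gtp nat

definition ace_rels ::
  "'f::field \<Rightarrow> ((ace_gen, 'f) free_elt \<times> (ace_gen, 'f) free_elt) set"
  where "ace_rels q =
    (let F = free_alg; \<rho> = - (q2 q)\<^sup>2;
         wm = \<lambda>k. free_gen (Wm k); wp = \<lambda>k. free_gen (Wp k);
         g = \<lambda>k. free_gen (Gp k); gt = \<lambda>k. free_gen (Gtp k)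
     in
     (\<Union>k. {
       (lie F (wm 0) (wp k), inverse (q + inverse q) \<odot>\<^bsub>F\<^esub> (gt k \<ominus>\<^bsub>F\<^esub> g k)),
       (lie F (wm k) (wp 0), inverse (q + inverse q) \<odot>\<^bsub>F\<^esub> (gt k \<ominus>\<^bsub>F\<^esub> g k)),
       (lie_r F q (wm 0) (g k), \<rho> \<odot>\<^bsub>F\<^esub> wm (k + 1) \<ominus>\<^bsub>F\<^esub> \<rho> \<odot>\<^bsub>F\<^esub> wp k),
       (lie_r F q (gt k) (wm 0), \<rho> \<odot>\<^bsub>F\<^esub> wm (k + 1) \<ominus>\<^bsub>F\<^esub> \<rho> \<odot>\<^bsub>F\<^esub> wp k),
       (lie_r F q (g k) (wp 0), \<rho> \<odot>\<^bsub>F\<^esub> wp (k + 1) \<ominus>\<^bsub>F\<^esub> \<rho> \<odot>\<^bsub>F\<^esub> wm k),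
       (lie_r F q (wp 0) (gt k), \<rho> \<odot>\<^bsub>F\<^esub> wp (k + 1) \<ominus>\<^bsub>F\<^esub> \<rho> \<odot>\<^bsub>F\<^esub> wm k)})
     \<union> (\<Union>k l. {
       (lie F (wm k) (wm l), \<zero>\<^bsub>F\<^esub>),
       (lie F (wp k) (wp l), \<zero>\<^bsub>F\<^esub>),
       (lie F (wm k) (wp l) \<oplus>\<^bsub>F\<^esub> lie F (wp k) (wm l), \<zero>\<^bsub>F\<^esub>),
       (lie F (wm k) (g l) \<oplus>\<^bsub>F\<^esub> lie F (g k) (wm l), \<zero>\<^bsub>F\<^esub>),
       (lie F (wm k) (gt l) \<oplus>\<^bsub>F\<^esub> lie F (gt k) (wm l), \<zero>\<^bsub>F\<^esub>),
       (lie F (wp k) (g l) \<oplus>\<^bsub>F\<^esub> lie F (g k) (wp l), \<zero>\<^bsub>F\<^esub>),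
       (lie F (wp k) (gt l) \<oplus>\<^bsub>F\<^esub> lie F (gt k) (wp l), \<zero>\<^bsub>F\<^esub>),
       (lie F (g k) (g l), \<zero>\<^bsub>F\<^esub>),
       (lie F (gt k) (gt l), \<zero>\<^bsub>F\<^esub>),
       (lie F (gt k) (g l) \<oplus>\<^bsub>F\<^esub> lie F (g k) (gt l), \<zero>\<^bsub>F\<^esub>)}))"

definition ace :: "'f::field \<Rightarrow> ('f, (ace_gen, 'f) free_elt set) module"
  where "ace q = presented_alg (ace_rels q)"

definition ace_W_minus :: "'f::field \<Rightarrow> nat \<Rightarrow> (ace_gen, 'f) free_elt set"
  where "ace_W_minus q n = presented_gen (ace_rels q) (Wm n)"

definition ace_W_plus :: "'f::field \<Rightarrow> nat \<Rightarrow> (ace_gen, 'f) free_elt set"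
  where "ace_W_plus q n = presented_gen (ace_rels q) (Wp n)"

text \<open>Unlike the generators \<open>Gtp\<close>, this sequence starts with the scalar term at index \<open>0\<close>.\<close>

definition ace_G_tilde :: "'f::field \<Rightarrow> nat \<Rightarrow> (ace_gen, 'f) free_elt set"
  where "ace_G_tilde q n =
    (case n of
       0 \<Rightarrow> (- ((q - inverse q) * (q_int q 2)\<^sup>2)) \<odot>\<^bsub>ace q\<^esub> \<one>\<^bsub>ace q\<^esub>
     | Suc k \<Rightarrow> presented_gen (ace_rels q) (Gtp k))"

abbreviation ace_series :: "'f::field \<Rightarrow> ('f fps, nat \<Rightarrow> (ace_gen, 'f) free_elt set) module"
  where "ace_series q \<equiv> series_alg (ace q)"

text \<open>The expansion of \<open>(q + q\<^sup>-\<^sup>1) / (t + t\<^sup>-\<^sup>1)\<close> in nonnegative powers of \<open>t\<close>.\<close>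

definition arg_series :: "'f::field \<Rightarrow> 'f fps"
  where "arg_series q =
    fps_const (q + inverse q) * Abs_fps (\<lambda>n. if odd n then (-1) ^ (n div 2) else 0)"

text \<open>The expansion of \<open>(t - t\<^sup>-\<^sup>1)\<^sup>-\<^sup>1\<close> in nonnegative powers of \<open>t\<close>.\<close>

definition inv_t_diff :: "'f::field fps"
  where "inv_t_diff = - Abs_fps (\<lambda>n. if odd n then 1 else 0)"

end

theory Submission
  imports Defs
begin

text \<open>
  The element \<open>\<Omega> = q B\<^sub>\<delta> + \<G>\<^sub>1\<close> (with \<open>\<G>\<^sub>1\<close> the tilde generator) commutes with all \<open>\<W>\<^sub>k\<close> and all tilde
  generators, so on these \<open>[B\<^sub>\<delta>, -]\<close> agrees with \<open>-q\<^sup>-\<^sup>1 [\<G>\<^sub>1, -]\<close>. The defining relations then express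
  \<open>s [B\<^sub>\<delta>, \<W>\<^sup>-(s)]\<close> and \<open>s [B\<^sub>\<delta>, \<W>\<^sup>+(s)]\<close> as combinations of \<open>\<W>\<^sup>-(s)\<close>, \<open>\<W>\<^sup>+(s)\<close>, \<open>\<W>\<^sub>0 \<G>(s)\<close> and
  \<open>\<W>\<^sub>1 \<G>(s)\<close>. For \<open>s = (q + q\<^sup>-\<^sup>1) / (t + t\<^sup>-\<^sup>1)\<close> it follows that \<open>B\<^sup>-(q t) \<G>(s)\<close> and
  \<open>-K (\<W>\<^sup>-(s) - q\<^sup>-\<^sup>1 t \<W>\<^sup>+(s))\<close>, where \<open>K = (q\<^sup>2 - q\<^sup>-\<^sup>2) (q + q\<^sup>-\<^sup>1) / (1 + t\<^sup>2)\<close>, solve the same recursion in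
  the powers of \<open>t\<close>, which has only one solution. In the same way \<open>B\<^sup>+(q\<^sup>-\<^sup>1 t) \<G>(s)\<close> is
  \<open>-K (\<W>\<^sup>+(s) - q t \<W>\<^sup>-(s))\<close>, and the two identities result by solving this \<open>2 \<times> 2\<close> system.
\<close>


section \<open>Associative algebras and their ideals\<close>

text \<open>The scalars form only a commutative ring, because the locale is used a second time with
  scalar power series acting on power series over the algebra.\<close>

locale assoc_algebra = Modules.module scale
  for scale :: "'f::comm_ring_1 \<Rightarrow> 'a::ring_1 \<Rightarrow> 'a" (infixr "*s" 75) +
  assumes mult_scale_left: "(c *s x) * y = c *s (x * y)"
    and mult_scale_right: "x * (c *s y) = c *s (x * y)"
begin

lemmas scale_expand = scale_left_distrib scale_right_distrib scale_left_diff_distrib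
  scale_right_diff_distrib mult_scale_left mult_scale_right distrib_left distrib_right
  left_diff_distrib right_diff_distrib mult.assoc

end

text \<open>
  Congruences modulo the two-sided ideal \<open>I\<close> replace equations in the quotient algebra, which is
  not a type and so has no type class operations.
\<close>

locale algebra_ideal = assoc_algebra scale
  for scale :: "'f::comm_ring_1 \<Rightarrow> 'a::ring_1 \<Rightarrow> 'a" (infixr "*s" 75) +
  fixes I :: "'a set"
  assumes zero_mem: "0 \<in> I"
    and add_mem: "x \<in> I \<Longrightarrow> y \<in> I \<Longrightarrow> x + y \<in> I"
    and mult_left_mem: "x \<in> I \<Longrightarrow> z * x \<in> I"
    and mult_right_mem: "x \<in> I \<Longrightarrow> x * z \<in> I"
begin

text \<open>Scaling by \<open>c\<close> is left multiplication by \<open>c *s 1\<close>, so a ring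
  ideal is also a submodule.\<close>

lemma scale_mem: "x \<in> I \<Longrightarrow> c *s x \<in> I"
  using mult_left_mem[of x "c *s 1"] by (simp add: mult_scale_left)

lemma minus_mem: "x \<in> I \<Longrightarrow> - x \<in> I"
  using mult_left_mem[of x "-1"] by simp

lemma diff_mem: "x \<in> I \<Longrightarrow> y \<in> I \<Longrightarrow> x - y \<in> I"
  using add_mem[OF _ minus_mem, of x y] by simp

lemma sum_mem: "(\<And>i. i \<in> A \<Longrightarrow> f i \<in> I) \<Longrightarrow> sum f A \<in> I"
  by (induction A rule: infinite_finite_induct) (auto intro: zero_mem add_mem)

end


section \<open>Power series over an algebra\<close>

text \<open>\<open>fps_scale\<close> and \<open>fps_subst\<close> copy the scalar action of
  \<open>series_alg\<close> and the map \<open>series_subst\<close>, but over a ring type, where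
  \<open>'a fps\<close> has its usual arithmetic.\<close>

definition fps_scale :: "('f::comm_ring_1 \<Rightarrow> 'a \<Rightarrow> 'a) \<Rightarrow> 'f fps \<Rightarrow> 'a::ring_1 fps \<Rightarrow> 'a fps"
  where "fps_scale sc a f = Abs_fps (\<lambda>n. \<Sum>i\<le>n. sc (fps_nth a i) (fps_nth f (n - i)))"

definition fps_subst :: "('f::comm_ring_1 \<Rightarrow> 'a \<Rightarrow> 'a) \<Rightarrow> (nat \<Rightarrow> 'a) \<Rightarrow> 'f fps \<Rightarrow> 'a::ring_1 fps"
  where "fps_subst sc f s = Abs_fps (\<lambda>n. \<Sum>k\<le>n. sc (fps_nth (s ^ k) n) (f k))"

definition fps_ideal :: "'a set \<Rightarrow> 'a fps set"
  where "fps_ideal I = {f. \<forall>n. fps_nth f n \<in> I}"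

context assoc_algebra
begin

text \<open>Identifies scalar series with central elements of \<open>'a fps\<close>, which reduces
  the laws of \<open>fps_scale\<close> to ring laws.\<close>

definition fps_embed :: "'f fps \<Rightarrow> 'a fps"
  where "fps_embed a = Abs_fps (\<lambda>n. fps_nth a n *s 1)"

lemma fps_scale_eq: "fps_scale scale a f = fps_embed a * f"
  by (rule fps_ext)
    (simp add: fps_scale_def fps_embed_def fps_mult_nth mult_scale_left atLeast0AtMost)

lemma fps_embed_mult: "fps_embed (a * b) = fps_embed a * fps_embed b"
  by (rule fps_ext)
    (simp add: fps_embed_def fps_mult_nth mult_scale_left scale_sum_left)

lemma fps_embed_central: "f * fps_embed a = fps_embed a * f"
proof (rule fps_ext)
  fix n
  have "fps_nth (f * fps_embed a) n = (\<Sum>i=0..n. fps_nth a (n - i) *s fps_nth f i)"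
    by (simp add: fps_embed_def fps_mult_nth mult_scale_right)
  also have "\<dots> = (\<Sum>i=0..n. fps_nth a i *s fps_nth f (n - i))"
    by (rule sum.reindex_bij_witness[of _ "\<lambda>i. n - i" "\<lambda>i. n - i"]) auto
  also have "\<dots> = fps_nth (fps_embed a * f) n"
    by (simp add: fps_embed_def fps_mult_nth mult_scale_left)
  finally show "fps_nth (f * fps_embed a) n = fps_nth (fps_embed a * f) n" .
qed

lemma assoc_algebra_fps: "assoc_algebra (fps_scale scale)"
proof
  show "fps_scale scale (a + b) f = fps_scale scale a f + fps_scale scale b f" for a b f
    unfolding fps_scale_eq
    by (subst distrib_right[symmetric])
      (simp add: fps_embed_def fps_plus_def scale_left_distrib)
  show "fps_scale scale 1 f = f" for f
  proof -
    have "fps_embed 1 = 1"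
      by (rule fps_ext) (simp add: fps_embed_def)
    then show ?thesis
      by (simp add: fps_scale_eq)
  qed
  show "f * fps_scale scale a g = fps_scale scale a (f * g)" for a f g
    unfolding fps_scale_eq by (metis fps_embed_central mult.assoc)
qed (simp_all add: fps_scale_eq distrib_left fps_embed_mult mult.assoc)

lemma fps_scale_const_nth: "fps_nth (fps_scale scale (fps_const c) f) n = c *s fps_nth f n"
proof -
  have "fps_embed (fps_const c) = fps_const (c *s 1)"
    by (rule fps_ext) (simp add: fps_embed_def)
  then show ?thesis
    by (simp add: fps_scale_eq mult_scale_left)
qed

lemma fps_scale_X: "fps_scale scale fps_X f = fps_X * f"
proof -
  have "fps_embed fps_X = fps_X"
    by (rule fps_ext) (simp add: fps_embed_def fps_X_def)
  then show ?thesis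
    by (simp add: fps_scale_eq)
qed

lemma fps_subst_nth: "fps_nth (fps_subst scale f s) n = (\<Sum>k\<le>n. fps_nth (s ^ k) n *s f k)"
  by (simp add: fps_subst_def)

lemma fps_subst_add:
  "fps_subst scale (\<lambda>n. f n + g n) s = fps_subst scale f s + fps_subst scale g s"
  by (rule fps_ext) (simp add: fps_subst_nth scale_right_distrib sum.distrib)

lemma fps_subst_diff:
  "fps_subst scale (\<lambda>n. f n - g n) s = fps_subst scale f s - fps_subst scale g s"
  by (rule fps_ext) (simp add: fps_subst_nth scale_right_diff_distrib sum_subtractf)

lemma fps_subst_scale:
  "fps_subst scale (\<lambda>n. c *s f n) s = fps_scale scale (fps_const c) (fps_subst scale f s)"
  by (rule fps_ext)
    (simp add: fps_subst_nth fps_scale_const_nth scale_sum_right mult.commute)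

lemma fps_subst_mult_left:
  "fps_subst scale (\<lambda>n. x * f n) s = fps_const x * fps_subst scale f s"
  by (rule fps_ext) (simp add: fps_subst_nth mult_scale_right sum_distrib_left)

lemma fps_subst_mult_right:
  "fps_subst scale (\<lambda>n. f n * x) s = fps_subst scale f s * fps_const x"
  by (rule fps_ext) (simp add: fps_subst_nth mult_scale_left sum_distrib_right)

text \<open>Multiplying the sum of \<open>f k\<close> times \<open>s ^ k\<close> by \<open>s\<close>
  raises every exponent by one, which is an index shift in \<open>f\<close>. In this way relations
  linking the indices \<open>k\<close> and \<open>k + 1\<close> become identities with a factor
  \<open>s\<close>.\<close>

lemma fps_subst_shift:
  assumes "fps_nth s 0 = 0"
  shows "fps_scale scale s (fps_subst scale f s)
    = fps_subst scale (\<lambda>n. case n of 0 \<Rightarrow> 0 | Suc k \<Rightarrow> f k) s"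
proof (rule fps_ext)
  fix n
  have low: "fps_nth (s ^ k) m = 0" if "m < k" for k m
    using startsby_zero_power_prefix[OF assms, of k] that by blast
  have "fps_nth (fps_scale scale s (fps_subst scale f s)) n
      = (\<Sum>i\<le>n. \<Sum>k\<le>n - i. fps_nth s i *s fps_nth (s ^ k) (n - i) *s f k)"
    by (simp add: fps_scale_def fps_subst_nth scale_sum_right del: scale_scale)
  \<comment> \<open>By \<open>low\<close> the added terms with \<open>k > n - i\<close> vanish. Once
    the range is rectangular, the sums can be swapped, and the sum over \<open>i\<close> is a
    coefficient of \<open>s ^ Suc k\<close>.\<close>
  also have "\<dots> = (\<Sum>i\<le>n. \<Sum>k\<le>n. (fps_nth s i * fps_nth (s ^ k) (n - i)) *s f k)"
    by (intro sum.cong refl sum.mono_neutral_cong_left) (auto simp: low)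
  also have "\<dots> = (\<Sum>k\<le>n. fps_nth (s ^ Suc k) n *s f k)"
    by (subst sum.swap) (simp add: fps_mult_nth scale_sum_left atLeast0AtMost)
  \<comment> \<open>The summand \<open>k = n\<close> drops out, since \<open>s ^ Suc n\<close> has
    no term of degree \<open>n\<close>.\<close>
  also have "\<dots> = (\<Sum>k<n. fps_nth (s ^ Suc k) n *s f k)"
    by (simp add: lessThan_Suc_atMost[symmetric] low del: power_Suc)
  also have "\<dots> = fps_nth (fps_subst scale (\<lambda>n. case n of 0 \<Rightarrow> 0 | Suc k \<Rightarrow> f k) s) n"
    by (cases n) (simp_all add: fps_subst_nth sum.atMost_Suc_shift lessThan_Suc_atMost
        del: power_Suc sum.atMost_Suc)
  finally show "fps_nth (fps_scale scale s (fps_subst scale f s)) n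
      = fps_nth (fps_subst scale (\<lambda>n. case n of 0 \<Rightarrow> 0 | Suc k \<Rightarrow> f k) s) n" .
qed

lemma fps_subst_const_X_nth:
  "fps_nth (fps_subst scale f (fps_const c * fps_X)) n = c ^ n *s f n"
proof -
  have "fps_nth ((fps_const c * fps_X) ^ k) n = (if k = n then c ^ n else 0)" for k
    by (simp add: power_mult_distrib fps_const_power)
  then show ?thesis
    by (simp add: fps_subst_nth if_distrib[of "\<lambda>c. c *s _"] cong: if_cong)
qed

end

context algebra_ideal
begin

lemma algebra_ideal_fps: "algebra_ideal (fps_scale scale) (fps_ideal I)"
proof -
  interpret S: assoc_algebra "fps_scale scale"
    by (rule assoc_algebra_fps)
  show ?thesis
    by unfold_locales
      (auto simp: fps_ideal_def fps_mult_nth intro!: zero_mem add_mem sum_mem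
        intro: mult_left_mem mult_right_mem)
qed

lemma fps_subst_mem:
  "(\<And>n. f n \<in> I) \<Longrightarrow> fps_subst scale f s \<in> fps_ideal I"
  by (auto simp: fps_ideal_def fps_subst_nth intro!: scale_mem sum_mem)

end


section \<open>Closed forms of the two scalar series\<close>

lemma arg_series_eq:
  "arg_series q = fps_const (q + inverse q) * fps_X * inverse (1 + fps_X\<^sup>2)"
proof -
  define a :: "'a fps" where "a = Abs_fps (\<lambda>n. if odd n then (-1) ^ (n div 2) else 0)"
  have "a * (1 + fps_X\<^sup>2) = fps_X"
  proof (rule fps_ext)
    fix n
    consider "n = 0" | "n = 1" | m where "n = Suc (Suc m)"
      by (metis One_nat_def not0_implies_Suc)
    then show "fps_nth (a * (1 + fps_X\<^sup>2)) n = fps_nth fps_X n"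
      by cases (auto simp: a_def distrib_left fps_X_power_mult_right_nth)
  qed
  moreover have "(1 + fps_X\<^sup>2) * inverse (1 + fps_X\<^sup>2 :: 'a fps) = 1"
    by (rule inverse_mult_eq_1') (simp add: numeral_2_eq_2)
  ultimately have "a = fps_X * inverse (1 + fps_X\<^sup>2)"
    by (metis mult.assoc mult.right_neutral)
  then show ?thesis
    by (simp add: arg_series_def a_def mult.assoc)
qed

lemma inv_t_diff_eq: "inv_t_diff = - (fps_X * inverse (1 - fps_X\<^sup>2))"
proof -
  define a :: "'a fps" where "a = Abs_fps (\<lambda>n. if odd n then 1 else 0)"
  have "a * (1 - fps_X\<^sup>2) = fps_X"
  proof (rule fps_ext)
    fix n
    consider "n = 0" | "n = 1" | m where "n = Suc (Suc m)"
      by (metis One_nat_def not0_implies_Suc)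
    then show "fps_nth (a * (1 - fps_X\<^sup>2)) n = fps_nth fps_X n"
      by cases (auto simp: a_def right_diff_distrib fps_X_power_mult_right_nth)
  qed
  moreover have "(1 - fps_X\<^sup>2) * inverse (1 - fps_X\<^sup>2 :: 'a fps) = 1"
    by (rule inverse_mult_eq_1') (simp add: numeral_2_eq_2)
  ultimately have "a = fps_X * inverse (1 - fps_X\<^sup>2)"
    by (metis mult.assoc mult.right_neutral)
  then show ?thesis
    by (simp add: inv_t_diff_def a_def)
qed

section \<open>Second-order recursions and their generating functions\<close>

fun q_rec :: "('a \<Rightarrow> 'a) \<Rightarrow> 'a \<Rightarrow> 'a \<Rightarrow> nat \<Rightarrow> 'a::plus"
  where
    "q_rec D u v 0 = u"
  | "q_rec D u v (Suc 0) = v + D u"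
  | "q_rec D u v (Suc (Suc n)) = q_rec D u v n + D (q_rec D u v (Suc n))"

context assoc_algebra
begin

text \<open>The recursion of \<open>q_rec\<close> with \<open>D x = c *s (b * x - x * b)\<close>,
  written for generating functions in \<open>l * fps_X\<close>. In \<open>q_rec\<close>, the value
  \<open>v\<close> acts as the term of index \<open>-1\<close>.\<close>

definition series_op :: "'f \<Rightarrow> 'f \<Rightarrow> 'a \<Rightarrow> 'a fps \<Rightarrow> 'a fps"
  where "series_op l c b Z = Z - fps_scale scale ((fps_const l * fps_X)\<^sup>2) Z
    - fps_scale scale (fps_const (l * c) * fps_X) (fps_const b * Z - Z * fps_const b)"

lemma fps_scale_const_X_nth:
  "fps_nth (fps_scale scale (fps_const c * fps_X) f) n
    = (case n of 0 \<Rightarrow> 0 | Suc k \<Rightarrow> c *s fps_nth f k)"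
proof -
  interpret S: assoc_algebra "fps_scale scale"
    by (rule assoc_algebra_fps)
  show ?thesis
    by (cases n) (simp_all add: S.scale_scale[symmetric] fps_scale_const_nth fps_scale_X del: S.scale_scale)
qed

lemma fps_scale_const_X_square_nth:
  "fps_nth (fps_scale scale ((fps_const c * fps_X)\<^sup>2) f) n
    = (case n of Suc (Suc k) \<Rightarrow> c\<^sup>2 *s fps_nth f k | _ \<Rightarrow> 0)"
proof -
  interpret S: assoc_algebra "fps_scale scale"
    by (rule assoc_algebra_fps)
  have "fps_scale scale ((fps_const c * fps_X)\<^sup>2) f
    = fps_scale scale (fps_const c * fps_X) (fps_scale scale (fps_const c * fps_X) f)"
    by (simp add: power2_eq_square)
  then show ?thesis
    by (simp only: fps_scale_const_X_nth) (simp add: power2_eq_square split: nat.split)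
qed

lemmas series_op_nth = fps_scale_const_X_nth fps_scale_const_X_square_nth

text \<open>From degree 2 on everything cancels by the recursion; only \<open>u\<close> and the
  contribution of \<open>v\<close> in degree 1 survive.\<close>

lemma series_op_q_rec:
  "series_op l c b (fps_subst scale (q_rec (\<lambda>x. c *s (b * x - x * b)) u v) (fps_const l * fps_X))
    = fps_const u + fps_scale scale (fps_const l * fps_X) (fps_const v)"
proof (rule fps_ext)
  fix n
  consider "n = 0" | "n = 1" | m where "n = Suc (Suc m)"
    by (metis One_nat_def not0_implies_Suc)
  then show "fps_nth (series_op l c b
      (fps_subst scale (q_rec (\<lambda>x. c *s (b * x - x * b)) u v) (fps_const l * fps_X))) n
    = fps_nth (fps_const u + fps_scale scale (fps_const l * fps_X) (fps_const v)) n"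
    by cases (simp_all only: series_op_def fps_sub_nth fps_add_nth series_op_nth
        fps_mult_left_const_nth fps_mult_right_const_nth fps_subst_const_X_nth,
        simp_all add: scale_right_distrib scale_right_diff_distrib mult_scale_left
        mult_scale_right power2_eq_square mult_ac)
qed

lemma series_op_diff: "series_op l c b (Y - Z) = series_op l c b Y - series_op l c b Z"
proof -
  interpret S: assoc_algebra "fps_scale scale"
    by (rule assoc_algebra_fps)
  show ?thesis
    by (simp only: series_op_def S.scale_expand) (simp add: algebra_simps)
qed

end

context algebra_ideal
begin

text \<open>\<open>series_op\<close> is the identity minus terms that raise the degree, so it is
  injective modulo the ideal.\<close>

lemma series_op_mem_cancel:
  assumes "series_op l c b Z \<in> fps_ideal I"
  shows "Z \<in> fps_ideal I"
proof -
  have "fps_nth Z n \<in> I" for n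
  proof (induction n rule: less_induct)
    case (less n)
    have op: "fps_nth (series_op l c b Z) n \<in> I"
      using assms by (simp add: fps_ideal_def)
    \<comment> \<open>The last two summands involve only the coefficients \<open>n - 2\<close> and
      \<open>n - 1\<close> of \<open>Z\<close>, which the induction hypothesis covers.\<close>
    have "fps_nth Z n = fps_nth (series_op l c b Z) n
      + fps_nth (fps_scale scale ((fps_const l * fps_X)\<^sup>2) Z) n
      + fps_nth (fps_scale scale (fps_const (l * c) * fps_X)
          (fps_const b * Z - Z * fps_const b)) n"
      by (simp add: series_op_def)
    also have "\<dots> \<in> I"
      unfolding series_op_nth using less
      by (intro add_mem op)
        (auto split: nat.split intro!: scale_mem diff_mem zero_mem intro: mult_left_mem mult_right_mem)
    finally show ?case .
  qed
  then show ?thesis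
    by (simp add: fps_ideal_def)
qed

text \<open>Modulo the ideal, both series have the same image under the injective
  \<open>series_op\<close>.\<close>

lemma q_rec_series_unique:
  assumes "fps_const b * G - G * fps_const b \<in> fps_ideal I"
    and "series_op l c b Z - (fps_const u + fps_scale scale (fps_const l * fps_X) (fps_const v)) * G
      \<in> fps_ideal I"
  shows "fps_subst scale (q_rec (\<lambda>x. c *s (b * x - x * b)) u v) (fps_const l * fps_X) * G - Z
    \<in> fps_ideal I"
proof -
  interpret S: algebra_ideal "fps_scale scale" "fps_ideal I"
    by (rule algebra_ideal_fps)
  let ?F = "fps_subst scale (q_rec (\<lambda>x. c *s (b * x - x * b)) u v) (fps_const l * fps_X)"
  \<comment> \<open>Leibniz rule for the commutator of \<open>b\<close> with \<open>?F * G\<close>: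
    right multiplication by \<open>G\<close> commutes with \<open>series_op\<close> up to a multiple
    of the commutator of \<open>b\<close> and \<open>G\<close>.\<close>
  have "series_op l c b (?F * G) = series_op l c b ?F * G
      - fps_scale scale (fps_const (l * c) * fps_X) (?F * (fps_const b * G - G * fps_const b))"
    by (simp only: series_op_def S.scale_expand) (simp add: algebra_simps)
  then have "series_op l c b (?F * G - Z)
    = - fps_scale scale (fps_const (l * c) * fps_X) (?F * (fps_const b * G - G * fps_const b))
      - (series_op l c b Z
        - (fps_const u + fps_scale scale (fps_const l * fps_X) (fps_const v)) * G)"
    by (simp add: series_op_diff series_op_q_rec)
  also have "\<dots> \<in> fps_ideal I"
    by (intro S.diff_mem S.minus_mem S.scale_mem S.mult_left_mem assms)
  finally show ?thesis
    by (rule series_op_mem_cancel)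
qed

end


section \<open>Solving the recursion and the resulting linear system\<close>

context algebra_ideal
begin

text \<open>Take \<open>e\<close> times the relation for \<open>M\<close> minus
  \<open>e * l' * fps_X\<close> times the relation for \<open>N\<close>. Its commutator part is
  \<open>e * s\<close> times the commutator of \<open>b\<close> with
  \<open>M - l' * fps_X * N\<close>, and by \<open>params\<close> it equals the commutator term that
  \<open>series_op\<close> produces. The parameters stay abstract to serve both \<open>l = q\<close>
  and \<open>l = inverse q\<close>.\<close>

lemma series_op_solution:
  fixes b :: 'a and M N A B :: "'a fps" and k l l' c e r1 r2 r3 r4 :: 'f
    and s n :: "'f fps"
  assumes n: "(1 + fps_X\<^sup>2) * n = 1" and s_eq: "s = fps_const (l + l') * fps_X * n"
    and M: "fps_scale scale s (fps_const b * M - M * fps_const b)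
      + (fps_scale scale (fps_const r1) (M - fps_scale scale s N)
        + fps_scale scale (fps_const r2) A) \<in> fps_ideal I"
    and N: "fps_scale scale s (fps_const b * N - N * fps_const b)
      + (fps_scale scale (fps_const r3) (N - fps_scale scale s M)
        + fps_scale scale (fps_const r4) B) \<in> fps_ideal I"
    and params: "l * l' = 1" "e * r1 = - k" "e * r2 = - 1" "e * l' * r3 = l * k"
      "e * l' * r4 = l" "l * c * k = e * (l + l')"
  shows "series_op l c b
      (fps_scale scale (- (fps_const k * n)) (M - fps_scale scale (fps_const l' * fps_X) N))
    - (A + fps_scale scale (fps_const l * fps_X) B) \<in> fps_ideal I"
proof -
  interpret S: algebra_ideal "fps_scale scale" "fps_ideal I"
    by (rule algebra_ideal_fps)
  define K L L' E C R1 R2 R3 R4 where "K = fps_const k" and "L = fps_const l"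
    and "L' = fps_const l'" and "E = fps_const e" and "C = fps_const c" and "R1 = fps_const r1"
    and "R2 = fps_const r2" and "R3 = fps_const r3" and "R4 = fps_const r4"
  note fdefs = K_def L_def L'_def E_def C_def R1_def R2_def R3_def R4_def
  have s: "s = (L + L') * fps_X * n"
    by (simp add: s_eq fdefs)
  have LL: "L * L' = 1" and ER1: "E * R1 = - K" and ER2: "E * R2 = - 1"
    and ER3: "E * L' * R3 = L * K" and ER4: "E * L' * R4 = L"
    and LCK: "L * C * K = E * (L + L')"
    using params by (simp_all add: fdefs mult.assoc flip: fps_const_1_eq_1 fps_const_neg)
  have n0: "1 - (1 + fps_X\<^sup>2) * n = 0" and LL0: "1 - L * L' = 0" and ER10: "E * R1 + K = 0"
    and ER30: "E * L' * R3 - L * K = 0" and LCK0: "L * C * K - E * (L + L') = 0"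
    using n LL ER1 ER3 LCK by simp_all
  \<comment> \<open>\<open>a1\<close> to \<open>a5\<close> concern the coefficients left over at
    \<open>M\<close>, \<open>N\<close>, \<open>A\<close>, \<open>B\<close> and the commutators after
    this combination; each vanishes by the conditions on \<open>n\<close>, \<open>s\<close> and the
    parameters.\<close>
  have "- (K * n) + (L * fps_X)\<^sup>2 * (K * n) - E * R1 - E * L' * R3 * fps_X * s
    = K * (1 - (1 + fps_X\<^sup>2) * n) - (E * R1 + K) - (E * L' * R3 - L * K) * fps_X * s
      + K * fps_X\<^sup>2 * n * (1 - L * L')"
    by (simp add: s algebra_simps power2_eq_square)
  then have a1: "- (K * n) + (L * fps_X)\<^sup>2 * (K * n) - E * R1 - E * L' * R3 * fps_X * s = 0"
    by (simp only: n0 LL0 ER10 ER30) simp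
  have "K * n * (L' * fps_X) - (L * fps_X)\<^sup>2 * (K * n) * (L' * fps_X) + E * R1 * s
      + E * L' * R3 * fps_X
    = (E * R1 + K) * s + (E * L' * R3 - L * K) * fps_X
      + L * K * fps_X * (1 - (1 + fps_X\<^sup>2) * n) + L * K * fps_X ^ 3 * n * (1 - L * L')"
    by (simp add: s algebra_simps power2_eq_square power3_eq_cube)
  then have a2: "K * n * (L' * fps_X) - (L * fps_X)\<^sup>2 * (K * n) * (L' * fps_X) + E * R1 * s
      + E * L' * R3 * fps_X = 0"
    by (simp only: n0 LL0 ER10 ER30) simp
  have a3: "- 1 - E * R2 = 0"
    using ER2 by simp
  have a4: "E * L' * R4 * fps_X - L * fps_X = 0"
    using ER4 by simp
  have "L * C * fps_X * (K * n) - E * s = (L * C * K - E * (L + L')) * fps_X * n"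
    by (simp add: s algebra_simps)
  then have a5: "L * C * fps_X * (K * n) - E * s = 0"
    by (simp only: LCK0) simp
  let ?DM = "fps_const b * M - M * fps_const b" and ?DN = "fps_const b * N - N * fps_const b"
  let ?m = "fps_scale scale"
  \<comment> \<open>An identity in independent parameters; the last five summands carry the
    coefficients \<open>a1\<close> to \<open>a5\<close>.\<close>
  have "series_op l c b (?m (- (K * n)) (M - ?m (L' * fps_X) N)) - (A + ?m (L * fps_X) B)
    = ?m E (?m s ?DM + (?m R1 (M - ?m s N) + ?m R2 A))
      - ?m (E * L' * fps_X) (?m s ?DN + (?m R3 (N - ?m s M) + ?m R4 B))
      + ?m (- (K * n) + (L * fps_X)\<^sup>2 * (K * n) - E * R1 - E * L' * R3 * fps_X * s) M
      + ?m (K * n * (L' * fps_X) - (L * fps_X)\<^sup>2 * (K * n) * (L' * fps_X) + E * R1 * s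
          + E * L' * R3 * fps_X) N
      + ?m (- 1 - E * R2) A + ?m (E * L' * R4 * fps_X - L * fps_X) B
      + ?m (L * C * fps_X * (K * n) - E * s) (?DM - ?m (L' * fps_X) ?DN)"
    unfolding series_op_def fps_const_mult[symmetric] L_def[symmetric] C_def[symmetric]
    by (simp only: S.scale_expand) (simp add: algebra_simps power2_eq_square)
  also have "\<dots> \<in> fps_ideal I"
    unfolding a1 a2 a3 a4 a5 S.scale_zero_left
    by (rule M[folded fdefs] | rule N[folded fdefs] | rule S.add_mem | rule S.diff_mem
        | rule S.scale_mem | rule S.zero_mem)+
  finally show ?thesis
    by (simp only: fdefs)
qed

text \<open>Adding \<open>fps_const a * fps_X\<close> times the second congruence to the first
  eliminates \<open>N\<close> and leaves \<open>- k * (1 - fps_X\<^sup>2)\<close> times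
  \<open>M\<close>.\<close>

lemma series_pair_solve:
  fixes M N F1 F2 :: "'a fps" and a b :: 'f and s k t :: "'f fps"
  assumes F1: "F1 - fps_scale scale (- k) (M - fps_scale scale (fps_const a * fps_X) N) \<in> fps_ideal I"
    and F2: "F2 - fps_scale scale (- k) (N - fps_scale scale (fps_const b * fps_X) M) \<in> fps_ideal I"
    and ab: "a * b = 1" and t: "t * k * (1 - fps_X\<^sup>2) = - s"
  shows "fps_scale scale s M - fps_scale scale t (F1 + fps_scale scale (fps_const a * fps_X) F2)
    \<in> fps_ideal I"
proof -
  interpret S: algebra_ideal "fps_scale scale" "fps_ideal I"
    by (rule algebra_ideal_fps)
  define A B where "A = fps_const a" and "B = fps_const b"
  have "A * B = 1"
    using ab by (simp add: A_def B_def)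
  then have coeff: "s + t * k * (1 - A * B * fps_X\<^sup>2) = 0"
    using t by simp
  let ?m = "fps_scale scale"
  have "?m s M - ?m t (F1 + ?m (A * fps_X) F2)
    = - ?m t (F1 - ?m (- k) (M - ?m (A * fps_X) N)
        + ?m (A * fps_X) (F2 - ?m (- k) (N - ?m (B * fps_X) M)))
      + ?m (s + t * k * (1 - A * B * fps_X\<^sup>2)) M"
    by (simp only: S.scale_expand) (simp add: algebra_simps power2_eq_square)
  also have "\<dots> \<in> fps_ideal I"
    unfolding coeff S.scale_zero_left unfolding A_def B_def
    by (rule F1 | rule F2 | rule S.add_mem | rule S.minus_mem | rule S.scale_mem
        | rule S.zero_mem)+
  finally show ?thesis
    by (simp only: A_def)
qed

end


section \<open>The alternating central extension modulo its relations\<close>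

text \<open>Here \<open>wm k\<close> stands for \<open>\<W>\<close> with index \<open>-k\<close>,
  while \<open>wp k\<close>, \<open>g k\<close> and \<open>gt k\<close> have index
  \<open>k + 1\<close>. The condition \<open>q ^ 4 \<noteq> 1\<close> makes
  \<open>q - inverse q\<close> and \<open>q + inverse q\<close> nonzero.\<close>

locale ace_relations = algebra_ideal scale I
  for scale :: "'f::field \<Rightarrow> 'a::ring_1 \<Rightarrow> 'a" (infixr "*s" 75) and I :: "'a set" +
  fixes q :: 'f and wm wp g gt :: "nat \<Rightarrow> 'a"
  assumes q_nonzero: "q \<noteq> 0" and q_power4: "q ^ 4 \<noteq> 1"
    and rel_w0_wp: "(wm 0 * wp k - wp k * wm 0) - inverse (q + inverse q) *s (gt k - g k) \<in> I"
    and rel_wm_w1: "(wm k * wp 0 - wp 0 * wm k) - inverse (q + inverse q) *s (gt k - g k) \<in> I"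
    and rel_w0_g: "(q *s (wm 0 * g k) - inverse q *s (g k * wm 0))
      - (- (q2 q)\<^sup>2 *s wm (k + 1) - - (q2 q)\<^sup>2 *s wp k) \<in> I"
    and rel_gt_w0: "(q *s (gt k * wm 0) - inverse q *s (wm 0 * gt k))
      - (- (q2 q)\<^sup>2 *s wm (k + 1) - - (q2 q)\<^sup>2 *s wp k) \<in> I"
    and rel_g_w1: "(q *s (g k * wp 0) - inverse q *s (wp 0 * g k))
      - (- (q2 q)\<^sup>2 *s wp (k + 1) - - (q2 q)\<^sup>2 *s wm k) \<in> I"
    and rel_w1_gt: "(q *s (wp 0 * gt k) - inverse q *s (gt k * wp 0))
      - (- (q2 q)\<^sup>2 *s wp (k + 1) - - (q2 q)\<^sup>2 *s wm k) \<in> I"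
    and rel_wm_wm: "wm k * wm l - wm l * wm k \<in> I"
    and rel_wp_wp: "wp k * wp l - wp l * wp k \<in> I"
    and rel_wm_gt: "(wm k * gt l - gt l * wm k) + (gt k * wm l - wm l * gt k) \<in> I"
    and rel_wp_gt: "(wp k * gt l - gt l * wp k) + (gt k * wp l - wp l * gt k) \<in> I"
    and rel_gt_gt: "gt k * gt l - gt l * gt k \<in> I"
begin

section \<open>The commuting element \<open>\<Omega>\<close>\<close>

definition casimir :: 'a
  where "casimir = inverse q *s (wp 0 * wm 0) - q *s (wm 0 * wp 0) + gt 0"

lemma q_sum_nonzero: "q + inverse q \<noteq> 0"
proof
  assume "q + inverse q = 0"
  then have "q * q + 1 = 0"
    using q_nonzero by (simp add: field_simps)
  then have "q * q = - 1"
    by (simp add: eq_neg_iff_add_eq_0)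
  then have "q ^ 4 = 1"
    by (simp add: power4_eq_xxxx mult.assoc)
  then show False
    using q_power4 by simp
qed

lemma q_diff_nonzero: "q - inverse q \<noteq> 0"
proof
  assume "q - inverse q = 0"
  then have "q * q = 1"
    using q_nonzero by (simp add: field_simps)
  then have "q ^ 4 = 1"
    by (simp add: power4_eq_xxxx mult.assoc)
  then show False
    using q_power4 by simp
qed

lemma q2_eq: "q2 q = (q - inverse q) * (q + inverse q)"
  by (simp add: q2_def algebra_simps power2_eq_square)

lemma inverse_q_sum:
  "1 - inverse (q + inverse q) * q - inverse (q + inverse q) * inverse q = 0"
  using left_inverse[OF q_sum_nonzero] by (simp only: distrib_left) (simp add: algebra_simps)

text \<open>Commuting the two quadratic terms past \<open>wm k\<close> leaves products of
  \<open>gt k - g k\<close> with \<open>wm 0\<close>. As \<open>[wm 0, g k]_q\<close> and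
  \<open>[gt k, wm 0]_q\<close> agree modulo \<open>I\<close>, \<open>g k\<close> can be eliminated.
  What remains is \<open>[wm 0, gt k]\<close>, which cancels \<open>[gt 0, wm k]\<close> by
  \<open>rel_wm_gt\<close>.\<close>

lemma casimir_wm: "casimir * wm k - wm k * casimir \<in> I"
proof -
  define p r v where "p = inverse q" and "r = - (q2 q)\<^sup>2" and "v = inverse (q + p)"
  note defs = p_def[symmetric] r_def[symmetric] v_def[symmetric]
  note u = rel_wm_wm[of 0 k] rel_wm_w1[of k, unfolded defs] rel_wm_gt[of k 0]
    rel_w0_g[of k, unfolded defs] rel_gt_w0[of k, unfolded defs]
  \<comment> \<open>The last summand vanishes; with it the identity holds for independent \<open>p\<close>, \<open>q\<close>, \<open>v\<close>, and the
    same device is used for \<open>p * q = 1\<close> below.\<close>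
  have "casimir * wm k - wm k * casimir
    = p *s (wp 0 * (wm 0 * wm k - wm k * wm 0)) - q *s ((wm 0 * wm k - wm k * wm 0) * wp 0)
      - p *s (((wm k * wp 0 - wp 0 * wm k) - v *s (gt k - g k)) * wm 0)
      + q *s (wm 0 * ((wm k * wp 0 - wp 0 * wm k) - v *s (gt k - g k)))
      - ((wm k * gt 0 - gt 0 * wm k) + (gt k * wm 0 - wm 0 * gt k))
      + v *s (((q *s (gt k * wm 0) - p *s (wm 0 * gt k)) - (r *s wm (k + 1) - r *s wp k))
        - ((q *s (wm 0 * g k) - p *s (g k * wm 0)) - (r *s wm (k + 1) - r *s wp k)))
      + (1 - v * q - v * p) *s (gt k * wm 0 - wm 0 * gt k)"
    by (simp only: casimir_def p_def[symmetric] scale_expand) (simp add: algebra_simps)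
  also have "\<dots> \<in> I"
    unfolding inverse_q_sum[unfolded defs] scale_zero_left
    by (rule u | rule mult_left_mem, rule u | rule mult_right_mem, rule u
        | rule add_mem | rule diff_mem | rule scale_mem | rule zero_mem)+
  finally show ?thesis .
qed

text \<open>As for \<open>casimir_wm\<close>, with \<open>g k\<close> eliminated by comparing
  \<open>[g k, wp 0]_q\<close> and \<open>[wp 0, gt k]_q\<close>.\<close>

lemma casimir_wp: "casimir * wp k - wp k * casimir \<in> I"
proof -
  define p r v where "p = inverse q" and "r = - (q2 q)\<^sup>2" and "v = inverse (q + p)"
  note defs = p_def[symmetric] r_def[symmetric] v_def[symmetric]
  note u = rel_wp_wp[of 0 k] rel_w0_wp[of k, unfolded defs] rel_wp_gt[of k 0]
    rel_g_w1[of k, unfolded defs] rel_w1_gt[of k, unfolded defs]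
  have "casimir * wp k - wp k * casimir
    = p *s ((wp 0 * wp k - wp k * wp 0) * wm 0) - q *s (wm 0 * (wp 0 * wp k - wp k * wp 0))
      + p *s (wp 0 * ((wm 0 * wp k - wp k * wm 0) - v *s (gt k - g k)))
      - q *s (((wm 0 * wp k - wp k * wm 0) - v *s (gt k - g k)) * wp 0)
      - ((wp k * gt 0 - gt 0 * wp k) + (gt k * wp 0 - wp 0 * gt k))
      + v *s (((q *s (g k * wp 0) - p *s (wp 0 * g k)) - (r *s wp (k + 1) - r *s wm k))
        - ((q *s (wp 0 * gt k) - p *s (gt k * wp 0)) - (r *s wp (k + 1) - r *s wm k)))
      + (1 - v * q - v * p) *s (gt k * wp 0 - wp 0 * gt k)"
    by (simp only: casimir_def p_def[symmetric] scale_expand) (simp add: algebra_simps)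
  also have "\<dots> \<in> I"
    unfolding inverse_q_sum[unfolded defs] scale_zero_left
    by (rule u | rule mult_left_mem, rule u | rule mult_right_mem, rule u
        | rule add_mem | rule diff_mem | rule scale_mem | rule zero_mem)+
  finally show ?thesis .
qed

text \<open>With \<open>X = [gt k, wm 0]_q\<close> and \<open>Y = [wp 0, gt k]_q\<close>, the
  commutator of \<open>casimir - gt 0\<close> with \<open>gt k\<close> is
  \<open>[X, wp 0] + [Y, wm 0]\<close>. The relations make \<open>X\<close> and \<open>Y\<close>
  linear in the \<open>wm\<close> and \<open>wp\<close>, and the resulting brackets vanish or
  cancel, because \<open>[wm (k + 1), wp 0]\<close> and \<open>[wm 0, wp (k + 1)]\<close>
  agree.\<close>

lemma casimir_gt: "casimir * gt k - gt k * casimir \<in> I"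
proof -
  define p r v where "p = inverse q" and "r = - (q2 q)\<^sup>2" and "v = inverse (q + p)"
  note defs = p_def[symmetric] r_def[symmetric] v_def[symmetric]
  note u = rel_wm_w1[of "k + 1", unfolded defs] rel_w0_wp[of "k + 1", unfolded defs]
    rel_wm_wm[of 0 k] rel_wp_wp[of 0 k] rel_gt_gt[of 0 k]
    rel_gt_w0[of k, unfolded defs] rel_w1_gt[of k, unfolded defs]
  have "casimir * gt k - gt k * casimir
    = ((q *s (gt k * wm 0) - p *s (wm 0 * gt k)) - (r *s wm (k + 1) - r *s wp k)) * wp 0
      - wp 0 * ((q *s (gt k * wm 0) - p *s (wm 0 * gt k)) - (r *s wm (k + 1) - r *s wp k))
      + ((q *s (wp 0 * gt k) - p *s (gt k * wp 0)) - (r *s wp (k + 1) - r *s wm k)) * wm 0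
      - wm 0 * ((q *s (wp 0 * gt k) - p *s (gt k * wp 0)) - (r *s wp (k + 1) - r *s wm k))
      + (gt 0 * gt k - gt k * gt 0)
      + r *s (((wm (k + 1) * wp 0 - wp 0 * wm (k + 1)) - v *s (gt (k + 1) - g (k + 1)))
        - ((wm 0 * wp (k + 1) - wp (k + 1) * wm 0) - v *s (gt (k + 1) - g (k + 1)))
        + (wp 0 * wp k - wp k * wp 0) + (wm 0 * wm k - wm k * wm 0))"
    by (simp only: casimir_def p_def[symmetric] scale_expand) (simp add: algebra_simps)
  also have "\<dots> \<in> I"
    by (rule u | rule mult_left_mem, rule u | rule mult_right_mem, rule u
        | rule add_mem | rule diff_mem | rule scale_mem | rule zero_mem)+
  finally show ?thesis .
qed

section \<open>Commutators with the image of \<open>B\<^sub>\<delta>\<close>\<close>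

definition beta :: 'a
  where "beta = (inverse q)\<^sup>2 *s (wp 0 * wm 0) - wm 0 * wp 0"

text \<open>Since \<open>casimir = q *s beta + gt 0\<close> commutes with \<open>wm k\<close>, the
  bracket \<open>[beta, wm k]\<close> is \<open>- inverse q\<close> times
  \<open>[gt 0, wm k]\<close>, hence times \<open>[gt k, wm 0]\<close>. The relation
  \<open>rel_gt_w0\<close> then moves \<open>gt k\<close> to the right of
  \<open>wm 0\<close>.\<close>

lemma beta_wm:
  "(beta * wm k - wm k * beta) + (- (inverse q * q2 q)\<^sup>2 *s (wm (k + 1) - wp k)
    - ((inverse q)\<^sup>2 * (q - inverse q)) *s (wm 0 * gt k)) \<in> I"
proof -
  define p r where "p = inverse q" and "r = - (q2 q)\<^sup>2"
  note defs = p_def[symmetric] r_def[symmetric]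
  note u = casimir_wm[of k] rel_wm_gt[of k 0] rel_gt_w0[of k, unfolded defs]
  have pq: "1 - p * q = 0" and r: "- (inverse q * q2 q)\<^sup>2 = p\<^sup>2 * r"
    using q_nonzero by (simp_all add: p_def r_def power_mult_distrib)
  have "(beta * wm k - wm k * beta)
      + ((p\<^sup>2 * r) *s (wm (k + 1) - wp k) - (p\<^sup>2 * (q - p)) *s (wm 0 * gt k))
    = p *s (casimir * wm k - wm k * casimir)
      + p *s ((wm k * gt 0 - gt 0 * wm k) + (gt k * wm 0 - wm 0 * gt k))
      - (p * p) *s ((q *s (gt k * wm 0) - p *s (wm 0 * gt k)) - (r *s wm (k + 1) - r *s wp k))
      - (1 - p * q) *s (wm 0 * wp 0 * wm k - wm k * wm 0 * wp 0 + p *s (gt k * wm 0 - wm 0 * gt k))"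
    by (simp only: casimir_def beta_def p_def[symmetric] scale_expand power2_eq_square)
      (simp add: algebra_simps)
  also have "\<dots> \<in> I"
    unfolding pq scale_zero_left
    by (rule u | rule mult_left_mem, rule u | rule mult_right_mem, rule u
        | rule add_mem | rule diff_mem | rule scale_mem | rule zero_mem)+
  finally show ?thesis
    unfolding r by (simp only: p_def)
qed

lemma beta_wp:
  "(beta * wp k - wp k * beta) + ((q2 q)\<^sup>2 *s (wp (k + 1) - wm k)
    + (q - inverse q) *s (wp 0 * gt k)) \<in> I"
proof -
  define p r where "p = inverse q" and "r = - (q2 q)\<^sup>2"
  note defs = p_def[symmetric] r_def[symmetric]
  note u = casimir_wp[of k] rel_wp_gt[of k 0] rel_w1_gt[of k, unfolded defs]
  have pq: "1 - p * q = 0" and r: "(q2 q)\<^sup>2 = - r"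
    using q_nonzero by (simp_all add: p_def r_def)
  have "(beta * wp k - wp k * beta)
      + (- r *s (wp (k + 1) - wm k) + (q - p) *s (wp 0 * gt k))
    = p *s (casimir * wp k - wp k * casimir)
      + p *s ((wp k * gt 0 - gt 0 * wp k) + (gt k * wp 0 - wp 0 * gt k))
      + (p * q) *s ((q *s (wp 0 * gt k) - p *s (gt k * wp 0)) - (r *s wp (k + 1) - r *s wm k))
      - (1 - p * q) *s (wm 0 * wp 0 * wp k - wp k * wm 0 * wp 0 + p *s (gt k * wp 0)
        + r *s (wp (k + 1) - wm k) - q *s (wp 0 * gt k))"
    by (simp only: casimir_def beta_def p_def[symmetric] scale_expand power2_eq_square)
      (simp add: algebra_simps)
  also have "\<dots> \<in> I"
    unfolding pq scale_zero_left
    by (rule u | rule mult_left_mem, rule u | rule mult_right_mem, rule u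
        | rule add_mem | rule diff_mem | rule scale_mem | rule zero_mem)+
  finally show ?thesis
    unfolding r by (simp only: p_def)
qed

text \<open>Up to a scalar, \<open>beta\<close> is \<open>casimir - gt 0\<close>, and the tilde
  generators commute with each other.\<close>

lemma beta_gt: "beta * gt k - gt k * beta \<in> I"
proof -
  define p where "p = inverse q"
  note u = casimir_gt[of k] rel_gt_gt[of 0 k]
  have pq: "1 - p * q = 0"
    using q_nonzero by (simp add: p_def)
  have "beta * gt k - gt k * beta
    = p *s (casimir * gt k - gt k * casimir) - p *s (gt 0 * gt k - gt k * gt 0)
      - (1 - p * q) *s (wm 0 * wp 0 * gt k - gt k * wm 0 * wp 0)"
    by (simp only: casimir_def beta_def p_def[symmetric] scale_expand power2_eq_square)
      (simp add: algebra_simps)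
  also have "\<dots> \<in> I"
    unfolding pq scale_zero_left
    by (rule u | rule mult_left_mem, rule u | rule mult_right_mem, rule u
        | rule add_mem | rule diff_mem | rule scale_mem | rule zero_mem)+
  finally show ?thesis .
qed

definition gtilde :: "nat \<Rightarrow> 'a"
  where "gtilde = case_nat (- ((q - inverse q) * (q_int q 2)\<^sup>2) *s 1) gt"

lemma q_int_2: "q_int q 2 = q + inverse q"
  using q2_eq q_diff_nonzero by (simp add: q_int_def q2_def)

lemma beta_gtilde: "beta * gtilde n - gtilde n * beta \<in> I"
  by (cases n)
    (simp_all add: gtilde_def beta_gt mult_scale_left mult_scale_right zero_mem
      del: scale_minus_left)

text \<open>\<open>beta_wm\<close> reindexed by \<open>n = k + 1\<close>, ready for summation
  against powers of a series. At \<open>n = 0\<close> it holds because the scalar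
  \<open>gtilde 0\<close> makes the last term cancel the multiple of \<open>wm 0\<close>.\<close>

lemma beta_wm_shifted:
  "case_nat 0 (\<lambda>k. beta * wm k - wm k * beta) n
    + (- (inverse q * q2 q)\<^sup>2 *s (wm n - case_nat 0 wp n)
    - ((inverse q)\<^sup>2 * (q - inverse q)) *s (wm 0 * gtilde n)) \<in> I"
proof (cases n)
  case 0
  have "(inverse q)\<^sup>2 * (q - inverse q) * ((q - inverse q) * (q_int q 2)\<^sup>2) = (inverse q * q2 q)\<^sup>2"
    by (simp add: q_int_2 q2_eq power2_eq_square mult_ac)
  then show ?thesis
    by (simp add: 0 gtilde_def mult_scale_right zero_mem)
next
  case (Suc k)
  then show ?thesis
    using beta_wm[of k] by (simp add: gtilde_def)
qed

lemma beta_wp_shifted: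
  "case_nat 0 (\<lambda>k. beta * wp k - wp k * beta) n
    + ((q2 q)\<^sup>2 *s (wp n - case_nat 0 wm n)
    + (q - inverse q) *s (wp 0 * gtilde n)) \<in> I"
proof (cases n)
  case 0
  have "(q - inverse q) * ((q - inverse q) * (q_int q 2)\<^sup>2) = (q2 q)\<^sup>2"
    by (simp add: q_int_2 q2_eq power2_eq_square mult_ac)
  then show ?thesis
    by (simp add: 0 gtilde_def mult_scale_right zero_mem)
next
  case (Suc k)
  then show ?thesis
    using beta_wp[of k] by (simp add: gtilde_def)
qed

section \<open>Congruences between the substituted series\<close>

definition wm_series :: "'a fps"
  where "wm_series = fps_subst scale wm (arg_series q)"

definition wp_series :: "'a fps"
  where "wp_series = fps_subst scale wp (arg_series q)"

definition gt_series :: "'a fps"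
  where "gt_series = fps_subst scale gtilde (arg_series q)"

text \<open>\<open>minus_series\<close> represents \<open>B\<^sup>-(q t)\<close> and
  \<open>plus_series\<close> represents \<open>B\<^sup>+(q\<^sup>-\<^sup>1 t)\<close>; in the latter
  \<open>wm 0\<close> and \<open>wp 0\<close> change places and the constant changes sign.\<close>

definition minus_series :: "'a fps"
  where "minus_series = fps_subst scale
    (q_rec (\<lambda>x. B_const q *s (beta * x - x * beta)) (wm 0) (wp 0)) (fps_const q * fps_X)"

definition plus_series :: "'a fps"
  where "plus_series = fps_subst scale
    (q_rec (\<lambda>x. - B_const q *s (beta * x - x * beta)) (wp 0) (wm 0))
    (fps_const (inverse q) * fps_X)"

lemma arg_series_nth_0: "fps_nth (arg_series q) 0 = 0"
  by (simp add: arg_series_def)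

text \<open>The reversed \<open>fps_subst_shift\<close> turns the index shift by
  \<open>case_nat 0\<close> into the factor \<open>arg_series q\<close>.\<close>

lemmas fps_subst_simps = fps_subst_add fps_subst_diff fps_subst_scale fps_subst_mult_left
  fps_subst_mult_right fps_subst_shift[OF arg_series_nth_0, symmetric]

lemma beta_wm_series:
  "fps_scale scale (arg_series q) (fps_const beta * wm_series - wm_series * fps_const beta)
    + (fps_scale scale (fps_const (- (inverse q * q2 q)\<^sup>2))
        (wm_series - fps_scale scale (arg_series q) wp_series)
      + fps_scale scale (fps_const (- ((inverse q)\<^sup>2 * (q - inverse q))))
        (fps_const (wm 0) * gt_series)) \<in> fps_ideal I"
proof -
  \<comment> \<open>The last term is added with a negated coefficient, which is the shape that
    \<open>series_op_solution\<close> expects.\<close>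
  have "fps_subst scale (\<lambda>n. case_nat 0 (\<lambda>k. beta * wm k - wm k * beta) n
      + (- (inverse q * q2 q)\<^sup>2 *s (wm n - case_nat 0 wp n)
        + - ((inverse q)\<^sup>2 * (q - inverse q)) *s (wm 0 * gtilde n))) (arg_series q) \<in> fps_ideal I"
    by (rule fps_subst_mem) (use beta_wm_shifted in simp)
  then show ?thesis
    unfolding wm_series_def wp_series_def gt_series_def by (simp only: fps_subst_simps)
qed

lemma beta_wp_series:
  "fps_scale scale (arg_series q) (fps_const beta * wp_series - wp_series * fps_const beta)
    + (fps_scale scale (fps_const ((q2 q)\<^sup>2))
        (wp_series - fps_scale scale (arg_series q) wm_series)
      + fps_scale scale (fps_const (q - inverse q)) (fps_const (wp 0) * gt_series))
    \<in> fps_ideal I"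
proof -
  have "fps_subst scale (\<lambda>n. case_nat 0 (\<lambda>k. beta * wp k - wp k * beta) n
      + ((q2 q)\<^sup>2 *s (wp n - case_nat 0 wm n) + (q - inverse q) *s (wp 0 * gtilde n)))
      (arg_series q) \<in> fps_ideal I"
    by (rule fps_subst_mem) (rule beta_wp_shifted)
  then show ?thesis
    unfolding wm_series_def wp_series_def gt_series_def by (simp only: fps_subst_simps)
qed

lemma beta_gt_series: "fps_const beta * gt_series - gt_series * fps_const beta \<in> fps_ideal I"
proof -
  have "fps_subst scale (\<lambda>n. beta * gtilde n - gtilde n * beta) (arg_series q) \<in> fps_ideal I"
    by (rule fps_subst_mem) (rule beta_gtilde)
  then show ?thesis
    unfolding gt_series_def by (simp only: fps_subst_simps)
qed

definition coeff_series :: "'f fps"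
  where "coeff_series = fps_const (q2 q * (q + inverse q)) * inverse (1 + fps_X\<^sup>2)"

lemma inverse_one_plus_X2: "(1 + fps_X\<^sup>2) * inverse (1 + fps_X\<^sup>2 :: 'f fps) = 1"
  by (rule inverse_mult_eq_1') (simp add: numeral_2_eq_2)

text \<open>By \<open>series_op_solution\<close> with \<open>l = q\<close>, the second series
  satisfies the recursion of \<open>minus_series\<close> with initial data multiplied by
  \<open>gt_series\<close>; uniqueness applies because \<open>beta\<close> commutes with
  \<open>gt_series\<close>.\<close>

lemma minus_series_gt:
  "minus_series * gt_series
    - fps_scale scale (- coeff_series)
        (wm_series - fps_scale scale (fps_const (inverse q) * fps_X) wp_series) \<in> fps_ideal I"
proof -
  interpret S: algebra_ideal "fps_scale scale" "fps_ideal I"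
    by (rule algebra_ideal_fps)
  define d m where "d = q - inverse q" and "m = q + inverse q"
  have nz: "d \<noteq> 0" "m \<noteq> 0" "q \<noteq> 0"
    using q_diff_nonzero q_sum_nonzero q_nonzero by (simp_all add: d_def m_def)
  have "series_op q (B_const q) beta (fps_scale scale (- coeff_series)
        (wm_series - fps_scale scale (fps_const (inverse q) * fps_X) wp_series))
      - (fps_const (wm 0) * gt_series
        + fps_scale scale (fps_const q * fps_X) (fps_const (wp 0) * gt_series)) \<in> fps_ideal I"
    unfolding coeff_series_def
    \<comment> \<open>The value of \<open>e\<close> is forced by \<open>e * r2 = - 1\<close>, where
      \<open>r2\<close> is the coefficient of \<open>wm 0\<close> times \<open>gt_series\<close> in
      \<open>beta_wm_series\<close>.\<close>
    by (rule series_op_solution[OF inverse_one_plus_X2 arg_series_eq beta_wm_series beta_wp_series,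
          where e = "q\<^sup>2 / (q - inverse q)"];
        use nz in \<open>(simp only: B_const_def q2_eq d_def[symmetric] m_def[symmetric])?,
          simp add: field_simps power2_eq_square\<close>)
  then show ?thesis
    unfolding minus_series_def
    by (intro q_rec_series_unique beta_gt_series)
      (simp add: S.mult_scale_left distrib_right)
qed

lemma plus_series_gt:
  "plus_series * gt_series
    - fps_scale scale (- coeff_series)
        (wp_series - fps_scale scale (fps_const q * fps_X) wm_series) \<in> fps_ideal I"
proof -
  interpret S: algebra_ideal "fps_scale scale" "fps_ideal I"
    by (rule algebra_ideal_fps)
  define d m where "d = q - inverse q" and "m = q + inverse q"
  have nz: "d \<noteq> 0" "m \<noteq> 0" "q \<noteq> 0"
    using q_diff_nonzero q_sum_nonzero q_nonzero by (simp_all add: d_def m_def)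
  have m': "inverse q + q = m"
    by (simp add: m_def)
  have arg: "arg_series q = fps_const (inverse q + q) * fps_X * inverse (1 + fps_X\<^sup>2)"
    by (simp only: arg_series_eq add.commute)
  have "series_op (inverse q) (- B_const q) beta (fps_scale scale (- coeff_series)
        (wp_series - fps_scale scale (fps_const q * fps_X) wm_series))
      - (fps_const (wp 0) * gt_series
        + fps_scale scale (fps_const (inverse q) * fps_X) (fps_const (wm 0) * gt_series))
      \<in> fps_ideal I"
    unfolding coeff_series_def
    \<comment> \<open>Now \<open>l = inverse q\<close>, and \<open>e * r2 = - 1\<close> is solved
      for \<open>r2 = q - inverse q\<close>.\<close>
    by (rule series_op_solution[OF inverse_one_plus_X2 arg beta_wp_series beta_wm_series,
          where e = "- 1 / (q - inverse q)"];
        use nz in \<open>(simp only: B_const_def q2_eq m' d_def[symmetric] m_def[symmetric])?,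
          simp add: field_simps power2_eq_square\<close>)
  then show ?thesis
    unfolding plus_series_def
    by (intro q_rec_series_unique beta_gt_series)
      (simp add: S.mult_scale_left distrib_right)
qed

text \<open>The coefficient condition of \<open>series_pair_solve\<close>: the factor
  \<open>1 - fps_X\<^sup>2\<close> clears the denominator of \<open>inv_t_diff\<close>.\<close>

lemma inv_t_diff_coeff_series:
  "fps_const (inverse (q2 q)) * inv_t_diff * coeff_series * (1 - fps_X\<^sup>2) = - arg_series q"
proof -
  have "q2 q \<noteq> 0"
    using q_diff_nonzero q_sum_nonzero by (simp add: q2_eq)
  then have "inverse (q2 q) * (q2 q * (q + inverse q)) = q + inverse q"
    by simp
  moreover have "inverse (1 - fps_X\<^sup>2) * (1 - fps_X\<^sup>2) = (1 :: 'f fps)"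
    by (rule inverse_mult_eq_1) (simp add: numeral_2_eq_2)
  moreover have "fps_const (inverse (q2 q)) * inv_t_diff * coeff_series * (1 - fps_X\<^sup>2)
    = - (fps_const (inverse (q2 q) * (q2 q * (q + inverse q))) * fps_X * inverse (1 + fps_X\<^sup>2)
      * (inverse (1 - fps_X\<^sup>2) * (1 - fps_X\<^sup>2)))"
    unfolding coeff_series_def inv_t_diff_eq fps_const_mult[symmetric]
    by (simp only: mult_ac mult_minus_left mult_minus_right)
  ultimately show ?thesis
    by (simp only: arg_series_eq mult_1_right)
qed

theorem wm_series_eq:
  "fps_scale scale (arg_series q) wm_series
    - fps_scale scale (fps_const (inverse (q2 q)) * inv_t_diff)
      ((fps_scale scale (fps_const (inverse q) * fps_X) plus_series + minus_series) * gt_series)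
    \<in> fps_ideal I"
proof -
  interpret S: algebra_ideal "fps_scale scale" "fps_ideal I"
    by (rule algebra_ideal_fps)
  have "fps_scale scale (arg_series q) wm_series
    - fps_scale scale (fps_const (inverse (q2 q)) * inv_t_diff)
      (minus_series * gt_series
        + fps_scale scale (fps_const (inverse q) * fps_X) (plus_series * gt_series))
    \<in> fps_ideal I"
    by (rule series_pair_solve[OF minus_series_gt plus_series_gt _ inv_t_diff_coeff_series])
      (use q_nonzero in simp)
  then show ?thesis
    by (simp only: distrib_right S.mult_scale_left add.commute)
qed

theorem wp_series_eq:
  "fps_scale scale (arg_series q) wp_series
    - fps_scale scale (fps_const (inverse (q2 q)) * inv_t_diff)
      ((plus_series + fps_scale scale (fps_const q * fps_X) minus_series) * gt_series)
    \<in> fps_ideal I"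
proof -
  interpret S: algebra_ideal "fps_scale scale" "fps_ideal I"
    by (rule algebra_ideal_fps)
  have "fps_scale scale (arg_series q) wp_series
    - fps_scale scale (fps_const (inverse (q2 q)) * inv_t_diff)
      (plus_series * gt_series
        + fps_scale scale (fps_const q * fps_X) (minus_series * gt_series))
    \<in> fps_ideal I"
    by (rule series_pair_solve[OF plus_series_gt minus_series_gt _ inv_t_diff_coeff_series])
      (use q_nonzero in simp)
  then show ?thesis
    by (simp only: distrib_right S.mult_scale_left)
qed

end


section \<open>Presented algebras as quotients of the free algebra\<close>

abbreviation free_scale :: "'f::field \<Rightarrow> ('g, 'f) free_elt \<Rightarrow> ('g, 'f) free_elt"
  where "free_scale c x \<equiv> Poly_Mapping.single 0 c * x"

text \<open>It suffices to check monomials, where the empty word is neutral on both sides and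
  coefficients commute.\<close>

lemma single_zero_central:
  fixes x :: "('g, 'f::field) free_elt"
  shows "x * Poly_Mapping.single 0 c = Poly_Mapping.single 0 c * x"
proof (induction x rule: update_induct)
  case const
  show ?case
    by simp
next
  case (update f k b)
  have "Poly_Mapping.update k b f = f + Poly_Mapping.single k b"
    using update(1) by (intro poly_mapping_eqI) (auto simp: lookup_update lookup_add lookup_single
        in_keys_iff when_def)
  then show ?case
    using update(3) by (simp add: distrib_left distrib_right mult_single mult.commute)
qed

lemma free_alg_simps:
  "carrier free_alg = UNIV" "x \<otimes>\<^bsub>free_alg\<^esub> y = x * y" "\<one>\<^bsub>free_alg\<^esub> = 1"
  "\<zero>\<^bsub>free_alg\<^esub> = 0" "x \<oplus>\<^bsub>free_alg\<^esub> y = x + y" "c \<odot>\<^bsub>free_alg\<^esub> x = free_scale c x"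
  by (simp_all add: free_alg_def)

lemma free_alg_minus:
  fixes x y :: "('g, 'f::field) free_elt"
  shows "x \<ominus>\<^bsub>free_alg\<^esub> y = x - y"
proof -
  interpret ring "free_alg :: ('f, ('g, 'f) free_elt) module"
    by (rule ring_free_alg)
  have "\<ominus>\<^bsub>free_alg\<^esub> y = - y"
    by (rule minus_equality) (simp_all add: free_alg_simps)
  then show ?thesis
    by (simp add: a_minus_def free_alg_simps)
qed

lemma algebra_ideal_rel_ideal:
  fixes R :: "(('g, 'f::field) free_elt \<times> ('g, 'f) free_elt) set"
  shows "algebra_ideal free_scale (rel_ideal R)"
proof -
  interpret ideal "rel_ideal R" free_alg
    by (rule ideal_rel_ideal)
  show ?thesis
  proof
    show "x * free_scale c y = free_scale c (x * y)" for x y :: "('g, 'f) free_elt" and c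
      by (metis mult.assoc single_zero_central)
    show "0 \<in> rel_ideal R"
      using additive_subgroup.zero_closed[OF additive_subgroup_axioms] by (simp add: free_alg_simps)
    show "x + y \<in> rel_ideal R" if "x \<in> rel_ideal R" "y \<in> rel_ideal R" for x y
      using additive_subgroup.a_closed[OF additive_subgroup_axioms that]
      by (simp add: free_alg_simps)
    show "z * x \<in> rel_ideal R" if "x \<in> rel_ideal R" for x z
      using I_l_closed[OF that, of z] by (simp add: free_alg_simps)
    show "x * z \<in> rel_ideal R" if "x \<in> rel_ideal R" for x z
      using I_r_closed[OF that, of z] by (simp add: free_alg_simps)
  qed (simp_all add: distrib_left distrib_right single_add mult.assoc[symmetric] mult_single)
qed

lemma rel_ideal_memI: "(x, y) \<in> R \<Longrightarrow> x - y \<in> rel_ideal R"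
  unfolding rel_ideal_def
  by (rule subsetD[OF ring.genideal_self[OF ring_free_alg]]) (force simp: free_alg_simps)+

lemma rel_ideal_mem_zeroI: "(x, 0) \<in> R \<Longrightarrow> x \<in> rel_ideal R"
  using rel_ideal_memI[of x 0 R] by simp

text \<open>Every element of a presented algebra is such a class, and
  \<open>free_class_eq_iff\<close> translates its equations into congruences.\<close>

definition free_class ::
  "(('g, 'f::field) free_elt \<times> ('g, 'f) free_elt) set \<Rightarrow> ('g, 'f) free_elt \<Rightarrow> ('g, 'f) free_elt set"
  where "free_class R x = rel_ideal R +>\<^bsub>free_alg\<^esub> x"

lemma free_class_eq_iff: "free_class R x = free_class R y \<longleftrightarrow> x - y \<in> rel_ideal R"
  using ring.quotient_eq_iff_same_a_r_cos[OF ring_free_alg ideal_rel_ideal, of x y R]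
  by (simp add: free_class_def free_alg_simps free_alg_minus)

lemma carrier_presented_alg: "carrier (presented_alg R) = range (free_class R)"
  by (auto simp: presented_alg_simps FactRing_def A_RCOSETS_def' free_class_def free_alg_simps)

lemma free_class_closed: "free_class R x \<in> carrier (presented_alg R)"
  by (simp add: carrier_presented_alg)

lemma free_class_mult:
  "free_class R x \<otimes>\<^bsub>presented_alg R\<^esub> free_class R y = free_class R (x * y)"
  using ideal.rcoset_mult_add[OF ideal_rel_ideal, of x y R]
  by (simp add: presented_alg_simps FactRing_def free_class_def free_alg_simps)

lemma free_class_add:
  "free_class R x \<oplus>\<^bsub>presented_alg R\<^esub> free_class R y = free_class R (x + y)"
  using ideal.a_rcos_sum[OF ideal_rel_ideal, of x y R]
  by (simp add: presented_alg_simps FactRing_def free_class_def free_alg_simps)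

lemma free_class_one: "\<one>\<^bsub>presented_alg R\<^esub> = free_class R 1"
  by (simp add: presented_alg_simps FactRing_def free_class_def free_alg_simps)

lemma free_class_scale:
  "c \<odot>\<^bsub>presented_alg R\<^esub> free_class R x = free_class R (free_scale c x)"
  by (simp add: free_class_def smult_presented_alg free_alg_simps)

lemma free_class_zero: "\<zero>\<^bsub>presented_alg R\<^esub> = free_class R 0"
proof -
  interpret ring "presented_alg R"
    by (rule ring_presented_alg)
  have "free_class R 0 \<oplus>\<^bsub>presented_alg R\<^esub> free_class R 0 = free_class R 0"
    by (simp add: free_class_add)
  then show ?thesis
    by (simp add: free_class_closed)
qed

lemma free_class_minus:
  "free_class R x \<ominus>\<^bsub>presented_alg R\<^esub> free_class R y = free_class R (x - y)"
proof -
  interpret ring "presented_alg R"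
    by (rule ring_presented_alg)
  have "\<ominus>\<^bsub>presented_alg R\<^esub> free_class R y = free_class R (- y)"
    by (rule minus_equality) (simp_all add: free_class_add free_class_zero free_class_closed)
  then show ?thesis
    by (simp add: a_minus_def free_class_add)
qed

lemma free_class_finsum:
  assumes "finite A"
  shows "(\<Oplus>\<^bsub>presented_alg R\<^esub>i\<in>A. free_class R (f i)) = free_class R (\<Sum>i\<in>A. f i)"
proof -
  interpret ring "presented_alg R"
    by (rule ring_presented_alg)
  show ?thesis
    using assms
    by (induction A rule: finite_induct)
      (simp_all add: free_class_zero free_class_add free_class_closed)
qed

lemmas free_class_simps = free_class_mult free_class_add free_class_scale free_class_minus

lemma lie_free_class:
  "lie (presented_alg R) (free_class R x) (free_class R y) = free_class R (x * y - y * x)"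
  by (simp add: lie_def free_class_simps)

section \<open>Series over a presented algebra through representatives\<close>

lemma smult_series_alg_free_class:
  "a \<odot>\<^bsub>series_alg (presented_alg R)\<^esub> (\<lambda>n. free_class R (fps_nth f n))
    = (\<lambda>n. free_class R (fps_nth (fps_scale free_scale a f) n))"
  by (simp add: series_alg_def fps_scale_def free_class_scale free_class_finsum)

lemma mult_series_alg_free_class:
  "(\<lambda>n. free_class R (fps_nth f n)) \<otimes>\<^bsub>series_alg (presented_alg R)\<^esub> (\<lambda>n. free_class R (fps_nth g n))
    = (\<lambda>n. free_class R (fps_nth (f * g) n))"
  by (simp add: series_alg_def fps_mult_nth free_class_mult free_class_finsum atLeast0AtMost)

lemma add_series_alg_free_class:
  "(\<lambda>n. free_class R (fps_nth f n)) \<oplus>\<^bsub>series_alg (presented_alg R)\<^esub> (\<lambda>n. free_class R (fps_nth g n))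
    = (\<lambda>n. free_class R (fps_nth (f + g) n))"
  by (simp add: series_alg_def free_class_add)

lemma series_subst_free_class:
  "series_subst (presented_alg R) (\<lambda>n. free_class R (f n)) s
    = (\<lambda>n. free_class R (fps_nth (fps_subst free_scale f s) n))"
  by (simp add: fun_eq_iff series_subst_def fps_subst_def free_class_scale free_class_finsum)

lemmas series_alg_free_class = smult_series_alg_free_class mult_series_alg_free_class
  add_series_alg_free_class series_subst_free_class

lemma smult_closed_presented_alg:
  "x \<in> carrier (presented_alg R) \<Longrightarrow> c \<odot>\<^bsub>presented_alg R\<^esub> x \<in> carrier (presented_alg R)"
  by (auto simp: carrier_presented_alg free_class_scale)


section \<open>The images of the Onsager elements\<close>

lemma ace_relations_free:
  fixes q :: "'f::field"
  assumes "q \<noteq> 0" "q ^ 4 \<noteq> 1"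
  shows "ace_relations free_scale (rel_ideal (ace_rels q)) q (\<lambda>k. free_gen (Wm k))
    (\<lambda>k. free_gen (Wp k)) (\<lambda>k. free_gen (Gp k)) (\<lambda>k. free_gen (Gtp k))"
proof -
  interpret algebra_ideal free_scale "rel_ideal (ace_rels q)"
    by (rule algebra_ideal_rel_ideal)
  note unf = ace_rels_def Let_def lie_def lie_r_def free_alg_simps free_alg_minus
  show ?thesis
    \<comment> \<open>A relation is sought first in the one-index family, then in the two-index
      family with right-hand side zero. The \<open>fail\<close> after \<open>;\<close> rejects a
      first attempt that leaves a subgoal.\<close>
    by (unfold_locales;
        (rule assms
        | (rule rel_ideal_memI, unfold unf, rule UnI1, rule UN_I[OF UNIV_I],
            (rule insertI1 | rule insertI2)+); fail
        | (rule rel_ideal_mem_zeroI, unfold unf, rule UnI2, rule UN_I[OF UNIV_I],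
            rule UN_I[OF UNIV_I], (rule insertI1 | rule insertI2)+)))
qed

text \<open>A homomorphism carries the recursion over. The sequence \<open>f\<close> is arbitrary so
  that \<open>B_alpha0\<close> and \<open>B_alpha1\<close> are both covered.\<close>

lemma alg_hom_q_rec:
  assumes h: "h \<in> alg_hom (presented_alg R) (presented_alg R')"
    and u: "u \<in> carrier (presented_alg R)" "h u = free_class R' u'"
    and v: "v \<in> carrier (presented_alg R)" "h v = free_class R' v'"
    and b: "b \<in> carrier (presented_alg R)" "h b = free_class R' b'"
    and f0: "f 0 = u"
    and f1: "f (Suc 0) = v \<oplus>\<^bsub>presented_alg R\<^esub> c \<odot>\<^bsub>presented_alg R\<^esub> lie (presented_alg R) b u"
    and f2: "\<And>n. f (Suc (Suc n)) = f n \<oplus>\<^bsub>presented_alg R\<^esub>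
      c \<odot>\<^bsub>presented_alg R\<^esub> lie (presented_alg R) b (f (Suc n))"
  shows "h (f n) = free_class R' (q_rec (\<lambda>x. free_scale c (b' * x - x * b')) u' v' n)"
proof -
  interpret A: ring "presented_alg R"
    by (rule ring_presented_alg)
  interpret B: ring "presented_alg R'"
    by (rule ring_presented_alg)
  interpret ring_hom_ring "presented_alg R" "presented_alg R'" h
    by (rule ring_hom_ringI2[OF ring_presented_alg ring_presented_alg])
      (use h in \<open>simp add: alg_hom_def\<close>)
  have D: "c \<odot>\<^bsub>presented_alg R\<^esub> lie (presented_alg R) b x \<in> carrier (presented_alg R) \<and>
      h (c \<odot>\<^bsub>presented_alg R\<^esub> lie (presented_alg R) b x)
        = free_class R' (free_scale c (b' * x' - x' * b'))"
    if x: "x \<in> carrier (presented_alg R)" "h x = free_class R' x'" for x x'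
  proof -
    have "lie (presented_alg R) b x \<in> carrier (presented_alg R)"
      using b x by (simp add: lie_def)
    moreover have "h (lie (presented_alg R) b x) = free_class R' (b' * x' - x' * b')"
      using b x by (simp add: lie_def a_minus_def flip: lie_free_class)
    ultimately show ?thesis
      using h by (simp add: alg_hom_def smult_closed_presented_alg free_class_scale)
  qed
  \<comment> \<open>Membership in the carrier is part of the induction, since the homomorphism laws
    hold only there.\<close>
  have "f n \<in> carrier (presented_alg R)
      \<and> h (f n) = free_class R' (q_rec (\<lambda>x. free_scale c (b' * x - x * b')) u' v' n)"
  proof (induction n rule: induct_nat_012)
    case 0
    then show ?case
      using u f0 by simp
  next
    case 1
    then show ?case
      using D[OF u] v f1 by (simp add: free_class_add)
  next
    case (ge2 n)
    then show ?case
      using D[of "f (Suc n)"] f2 by (simp add: free_class_add)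
  qed
  then show ?thesis
    by simp
qed

text \<open>Brings the subtractions in \<open>B_alpha1\<close> into the additive form of
  \<open>alg_hom_q_rec\<close>, with constant \<open>- c\<close>.\<close>

lemma a_minus_smult_presented_alg:
  assumes "x \<in> carrier (presented_alg R)" "y \<in> carrier (presented_alg R)"
  shows "x \<ominus>\<^bsub>presented_alg R\<^esub> c \<odot>\<^bsub>presented_alg R\<^esub> y
    = x \<oplus>\<^bsub>presented_alg R\<^esub> (- c) \<odot>\<^bsub>presented_alg R\<^esub> y"
  using assms by (auto simp: carrier_presented_alg free_class_simps single_uminus)

theorem theorem9p8:
  fixes q :: "'f::field"
    and \<iota> :: "(onsager_gen, 'f) free_elt set \<Rightarrow> (ace_gen, 'f) free_elt set"
  assumes q_nonzero: "q \<noteq> 0"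
    and q_not_root_of_unity: "\<forall>n>0. q ^ n \<noteq> 1"
    and iota_hom: "\<iota> \<in> alg_hom (onsager q) (ace q)"
    and iota_inj: "inj_on \<iota> (carrier (onsager q))"
    and iota_W0: "\<iota> (onsager_W q W0) = ace_W_minus q 0"
    and iota_W1: "\<iota> (onsager_W q W1) = ace_W_plus q 0"
  defines "B_minus \<equiv> \<lambda>n. \<iota> (B_alpha0 q n)"
    and "B_plus \<equiv> \<lambda>n. \<iota> (B_alpha1 q n)"
  shows
    "arg_series q \<odot>\<^bsub>ace_series q\<^esub> series_subst (ace q) (ace_W_minus q) (arg_series q)
      = (fps_const (inverse (q2 q)) * inv_t_diff) \<odot>\<^bsub>ace_series q\<^esub>
          (((fps_const (inverse q) * fps_X) \<odot>\<^bsub>ace_series q\<^esub>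
               series_subst (ace q) B_plus (fps_const (inverse q) * fps_X)
             \<oplus>\<^bsub>ace_series q\<^esub> series_subst (ace q) B_minus (fps_const q * fps_X))
           \<otimes>\<^bsub>ace_series q\<^esub> series_subst (ace q) (ace_G_tilde q) (arg_series q))
     \<and>
     arg_series q \<odot>\<^bsub>ace_series q\<^esub> series_subst (ace q) (ace_W_plus q) (arg_series q)
      = (fps_const (inverse (q2 q)) * inv_t_diff) \<odot>\<^bsub>ace_series q\<^esub>
          ((series_subst (ace q) B_plus (fps_const (inverse q) * fps_X)
             \<oplus>\<^bsub>ace_series q\<^esub>
             (fps_const q * fps_X) \<odot>\<^bsub>ace_series q\<^esub>
               series_subst (ace q) B_minus (fps_const q * fps_X))
           \<otimes>\<^bsub>ace_series q\<^esub> series_subst (ace q) (ace_G_tilde q) (arg_series q))"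
proof -
  let ?R = "ace_rels q"
  have "q ^ 4 \<noteq> 1"
    using q_not_root_of_unity by simp
  then interpret ace_relations free_scale "rel_ideal (ace_rels q)" q "\<lambda>k. free_gen (Wm k)"
    "\<lambda>k. free_gen (Wp k)" "\<lambda>k. free_gen (Gp k)" "\<lambda>k. free_gen (Gtp k)"
    by (rule ace_relations_free[OF q_nonzero])
  interpret A: ring "onsager q"
    unfolding onsager_def by (rule ring_presented_alg)
  interpret ring_hom_ring "onsager q" "ace q" \<iota>
    by (rule ring_hom_ringI2)
      (use iota_hom ring_presented_alg in \<open>simp_all add: alg_hom_def onsager_def ace_def\<close>)
  have gens: "onsager_W q x \<in> carrier (onsager q)" for x
    by (simp add: onsager_W_def onsager_def presented_gen_def carrier_presented_alg
        flip: free_class_def)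
  have smult: "c \<odot>\<^bsub>onsager q\<^esub> x \<in> carrier (onsager q)" if "x \<in> carrier (onsager q)" for c x
    using that unfolding onsager_def by (rule smult_closed_presented_alg)
  have wm: "ace_W_minus q = (\<lambda>n. free_class ?R (free_gen (Wm n)))"
    and wp: "ace_W_plus q = (\<lambda>n. free_class ?R (free_gen (Wp n)))"
    by (simp_all add: fun_eq_iff ace_W_minus_def ace_W_plus_def presented_gen_def free_class_def)
  have gt: "ace_G_tilde q = (\<lambda>n. free_class ?R (gtilde n))"
    by (simp add: fun_eq_iff ace_G_tilde_def gtilde_def ace_def free_class_one free_class_scale
        presented_gen_def free_class_def[symmetric] split: nat.split)
  have beta_closed: "B_delta q \<in> carrier (onsager q)"
    unfolding B_delta_def by (simp add: gens smult)
  have beta: "\<iota> (B_delta q) = free_class ?R beta"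
  proof -
    have "\<iota> (c \<odot>\<^bsub>onsager q\<^esub> x) = c \<odot>\<^bsub>ace q\<^esub> \<iota> x" if "x \<in> carrier (onsager q)" for c x
      using iota_hom that by (simp add: alg_hom_def)
    moreover have "\<iota> (x \<ominus>\<^bsub>onsager q\<^esub> y) = \<iota> x \<ominus>\<^bsub>ace q\<^esub> \<iota> y"
      if "x \<in> carrier (onsager q)" "y \<in> carrier (onsager q)" for x y
      using that by (simp add: a_minus_def)
    ultimately show ?thesis
      by (simp add: B_delta_def gens smult iota_W0 iota_W1 wm wp)
        (simp add: ace_def free_class_simps beta_def)
  qed
  have minus: "B_minus = (\<lambda>n. free_class ?R (q_rec
      (\<lambda>x. free_scale (B_const q) (beta * x - x * beta)) (free_gen (Wm 0)) (free_gen (Wp 0)) n))"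
    unfolding B_minus_def fun_eq_iff
    by (intro allI alg_hom_q_rec[OF iota_hom[unfolded onsager_def ace_def]];
      use gens beta_closed beta wm wp iota_W0 iota_W1 in \<open>simp add: onsager_def\<close>)
  have plus: "B_plus = (\<lambda>n. free_class ?R (q_rec
      (\<lambda>x. free_scale (- B_const q) (beta * x - x * beta)) (free_gen (Wp 0)) (free_gen (Wm 0)) n))"
  proof -
    have B1: "x \<ominus>\<^bsub>onsager q\<^esub> B_const q \<odot>\<^bsub>onsager q\<^esub> lie (onsager q) (B_delta q) y
        = x \<oplus>\<^bsub>onsager q\<^esub> (- B_const q) \<odot>\<^bsub>onsager q\<^esub> lie (onsager q) (B_delta q) y"
      if "x \<in> carrier (onsager q)" "y \<in> carrier (onsager q)" for x y
    proof -
      have "lie (onsager q) (B_delta q) y \<in> carrier (onsager q)"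
        using that beta_closed by (simp add: lie_def)
      with that(1) show ?thesis
        unfolding onsager_def by (rule a_minus_smult_presented_alg)
    qed
    have closed: "B_alpha1 q n \<in> carrier (onsager q)" for n
      by (induction n rule: induct_nat_012) (simp_all add: gens smult beta_closed lie_def)
    show ?thesis
      unfolding B_plus_def fun_eq_iff
      by (intro allI alg_hom_q_rec[OF iota_hom[unfolded onsager_def ace_def]];
        use gens beta_closed beta wm wp iota_W0 iota_W1 B1 closed in \<open>simp add: onsager_def\<close>)
  qed
  have "arg_series q \<odot>\<^bsub>ace_series q\<^esub> series_subst (ace q) (ace_W_minus q) (arg_series q)
      = (fps_const (inverse (q2 q)) * inv_t_diff) \<odot>\<^bsub>ace_series q\<^esub>
          (((fps_const (inverse q) * fps_X) \<odot>\<^bsub>ace_series q\<^esub>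
               series_subst (ace q) B_plus (fps_const (inverse q) * fps_X)
             \<oplus>\<^bsub>ace_series q\<^esub> series_subst (ace q) B_minus (fps_const q * fps_X))
           \<otimes>\<^bsub>ace_series q\<^esub> series_subst (ace q) (ace_G_tilde q) (arg_series q))"
    \<comment> \<open>Both sides become sequences of classes of coefficients, and their equality is
      the membership in \<open>fps_ideal\<close> given by \<open>wm_series_eq\<close>.\<close>
    unfolding minus plus wm gt ace_def series_alg_free_class
    using wm_series_eq
    by (simp add: fun_eq_iff free_class_eq_iff fps_ideal_def wm_series_def gt_series_def
        minus_series_def plus_series_def)
  moreover have "arg_series q \<odot>\<^bsub>ace_series q\<^esub> series_subst (ace q) (ace_W_plus q) (arg_series q)
      = (fps_const (inverse (q2 q)) * inv_t_diff) \<odot>\<^bsub>ace_series q\<^esub>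
          ((series_subst (ace q) B_plus (fps_const (inverse q) * fps_X)
             \<oplus>\<^bsub>ace_series q\<^esub>
             (fps_const q * fps_X) \<odot>\<^bsub>ace_series q\<^esub>
               series_subst (ace q) B_minus (fps_const q * fps_X))
           \<otimes>\<^bsub>ace_series q\<^esub> series_subst (ace q) (ace_G_tilde q) (arg_series q))"
    unfolding minus plus wp gt ace_def series_alg_free_class
    using wp_series_eq
    by (simp add: fun_eq_iff free_class_eq_iff fps_ideal_def wp_series_def gt_series_def
        minus_series_def plus_series_def)
  ultimately show ?thesis
    by blast
qed

end
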